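(* Let $V$ be a vertex operator algebra of CFT type. If $V$ is $C_2$-cofinite, then any irreducible weak $V$-module is an irreducible ordinary $V$-module.
   Context: A vertex operator algebra $(V,Y,\mathbf 1,\omega)$ over $\mathbb C$ has grading $V=\bigoplus_{n}V_n$ by $L(0)$-eigenvalues (with $\dim V_n<\infty$), where $Y(\omega,z)=\sum_n L(n)z^{-n-2}$; write $Y(v,z)=\sum_{n\in\mathbb Z}v_nz^{-n-1}$. $V$ is of CFT type if $V=\bigoplus_{n\ge 0}V_n$ and $V_0=\mathbb C\mathbf 1$. $C_2$-cofinite: $\dim V/C_2(V)<\infty$, where $C_2(V)$ is the linear span of $\{v_{-2}w\mid v,w\in V\}$. Weak $V$-module: a vector space $M$ with a linear map $v\mapsto Y_M(v,z)=\sum_{n\in\mathbb Z}v_nz^{-n-1}$, $v_n\in\mathrm{End}(M)$, such that (1) for $v\in V$, $w\in M$, $v_nw=0$ for $n\gg0$; (2) $Y_M(\mathbf 1,z)=\mathrm{Id}_M$; (3) the Jacobi identity holds: $z_0^{-1}\delta(\frac{z_1-z_2}{z_0})Y_M(u,z_1)Y_M(v,z_2)-z_0^{-1}\delta(\frac{z_2-z_1}{-z_0})Y_M(v,z_2)Y_M(u,z_1)=z_2^{-1}\delta(\frac{z_1-z_0}{z_2})Y_M(Y(u,z_0)v,z_2)$. No grading is assumed. Ordinary $V$-module: a weak $V$-module with a grading $M=\bigoplus_{\lambda\in\mathbb C}M_\lambda$ such that $\dim M_\lambda<\infty$; for fixed $\lambda$, $M_{\lambda+n}=0$ for $n\ll0$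 ($n\in\mathbb Z$); and $L(0)w=\lambda w$ for $w\in M_\lambda$. *)

theory Defs
  imports Complex_Main "HOL-Library.Groups_Big_Fun"
begin

definition finite_dimensional :: "(complex \<Rightarrow> 'a::ab_group_add \<Rightarrow> 'a) \<Rightarrow> 'a set \<Rightarrow> bool" where
  "finite_dimensional scale W \<longleftrightarrow> (\<exists>B. finite B \<and> B \<subseteq> W \<and> module.span scale B = W)"

text \<open>The quotient of the whole space by \<open>W\<close> is finite-dimensional: it is spanned by the
  cosets of finitely many vectors.\<close>

definition finite_dimensional_quotient ::
    "(complex \<Rightarrow> 'a::ab_group_add \<Rightarrow> 'a) \<Rightarrow> 'a set \<Rightarrow> bool" where
  "finite_dimensional_quotient scale W \<longleftrightarrow>
     (\<exists>B. finite B \<and> (\<forall>x. \<exists>y \<in> module.span scale B. x - y \<in> W))"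

definition is_direct_sum ::
    "(complex \<Rightarrow> 'a::ab_group_add \<Rightarrow> 'a) \<Rightarrow> 'i set \<Rightarrow> ('i \<Rightarrow> 'a set) \<Rightarrow> bool" where
  "is_direct_sum scale I W \<longleftrightarrow>
     (\<forall>i\<in>I. module.subspace scale (W i)) \<and>
     (\<forall>x. \<exists>!f. finite {i. f i \<noteq> 0} \<and> (\<forall>i\<in>I. f i \<in> W i) \<and> (\<forall>i. i \<notin> I \<longrightarrow> f i = 0) \<and>
               x = Sum_any f)"

text \<open>
  A field \<open>Y(v,z) = \<Sum>\<^sub>n v\<^sub>n z\<^bsup>-n-1\<^esup>\<close> is represented by its modes: \<open>Y v n w\<close> stands for \<open>v\<^sub>n w\<close>.
  Formal distributions in \<open>z\<^sub>0, z\<^sub>1, z\<^sub>2\<close> are represented by their coefficient functions, where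
  the arguments \<open>a b c\<close> stand for the monomial \<open>z\<^sub>0\<^sup>a z\<^sub>1\<^sup>b z\<^sub>2\<^sup>c\<close>.
\<close>

text \<open>Coefficient of \<open>x\<^sup>i y\<^sup>j\<close> in \<open>(x - y)\<^sup>n\<close>, expanded in nonnegative powers of the second
  variable \<open>y\<close> (the usual convention, also for negative \<open>n\<close>).\<close>

definition diff_power_coeff :: "int \<Rightarrow> int \<Rightarrow> int \<Rightarrow> complex" where
  "diff_power_coeff n i j =
     (if j \<ge> 0 \<and> i + j = n then (-1) ^ nat j * (of_int n gchoose nat j) else 0)"

text \<open>The three delta functions below come from \<open>\<delta>(z) = \<Sum>\<^sub>n z\<^sup>n\<close>, the sum being over all integers:
  \<^item> \<open>z\<^sub>0\<^bsup>-1\<^esup> \<delta>((z\<^sub>1 - z\<^sub>2) / z\<^sub>0) = \<Sum>\<^sub>n z\<^sub>0\<^bsup>-n-1\<^esup> (z\<^sub>1 - z\<^sub>2)\<^sup>n\<close>,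
  \<^item> \<open>z\<^sub>0\<^bsup>-1\<^esup> \<delta>((z\<^sub>2 - z\<^sub>1) / (-z\<^sub>0)) = \<Sum>\<^sub>n (-1)\<^sup>n z\<^sub>0\<^bsup>-n-1\<^esup> (z\<^sub>2 - z\<^sub>1)\<^sup>n\<close>,
  \<^item> \<open>z\<^sub>2\<^bsup>-1\<^esup> \<delta>((z\<^sub>1 - z\<^sub>0) / z\<^sub>2) = \<Sum>\<^sub>n z\<^sub>2\<^bsup>-n-1\<^esup> (z\<^sub>1 - z\<^sub>0)\<^sup>n\<close>.
\<close>

definition delta_12_0 :: "int \<Rightarrow> int \<Rightarrow> int \<Rightarrow> complex" where
  "delta_12_0 a b c = diff_power_coeff (- a - 1) b c"

definition delta_21_0 :: "int \<Rightarrow> int \<Rightarrow> int \<Rightarrow> complex" where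
  "delta_21_0 a b c = (-1) powi (- a - 1) * diff_power_coeff (- a - 1) c b"

definition delta_10_2 :: "int \<Rightarrow> int \<Rightarrow> int \<Rightarrow> complex" where
  "delta_10_2 a b c = diff_power_coeff (- c - 1) b a"

text \<open>
  Equality of the coefficients of \<open>z\<^sub>0\<^sup>a z\<^sub>1\<^sup>b z\<^sub>2\<^sup>c\<close> on both sides of the Jacobi identity, applied to
  a vector \<open>w\<close>. Each product of a delta function with fields is a convolution; e.g. the mode
  \<open>u\<^sub>m\<close> carries \<open>z\<^sub>1\<^bsup>-m-1\<^esup>\<close> and so meets the power \<open>z\<^sub>1\<^bsup>b+m+1\<^esup>\<close> of the delta function. All three
  sums have only finitely many nonzero terms when \<open>Y\<close> and \<open>YM\<close> satisfy the truncation condition.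
\<close>

definition jacobi_identity ::
    "('v \<Rightarrow> int \<Rightarrow> 'v \<Rightarrow> 'v) \<Rightarrow> (complex \<Rightarrow> 'm::ab_group_add \<Rightarrow> 'm) \<Rightarrow>
     ('v \<Rightarrow> int \<Rightarrow> 'm \<Rightarrow> 'm) \<Rightarrow> bool" where
  "jacobi_identity Y scaleM YM \<longleftrightarrow>
     (\<forall>u v w a b c.
        Sum_any (\<lambda>(m, n). scaleM (delta_12_0 a (b + m + 1) (c + n + 1)) (YM u m (YM v n w)))
        - Sum_any (\<lambda>(m, n). scaleM (delta_21_0 a (b + m + 1) (c + n + 1)) (YM v n (YM u m w)))
        = Sum_any (\<lambda>(l, n). scaleM (delta_10_2 (a + l + 1) b (c + n + 1)) (YM (Y u l v) n w)))"

text \<open>\<open>Y(\<omega>,z) = \<Sum>\<^sub>n L(n) z\<^bsup>-n-2\<^esup>\<close>\<close>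

definition Lmode :: "('v \<Rightarrow> int \<Rightarrow> 'm \<Rightarrow> 'm) \<Rightarrow> 'v \<Rightarrow> int \<Rightarrow> 'm \<Rightarrow> 'm" where
  "Lmode Y \<omega> n = Y \<omega> (n + 1)"

definition weight_space ::
    "(complex \<Rightarrow> 'v \<Rightarrow> 'v) \<Rightarrow> ('v \<Rightarrow> int \<Rightarrow> 'v \<Rightarrow> 'v) \<Rightarrow> 'v \<Rightarrow> int \<Rightarrow> 'v set" where
  "weight_space scale Y \<omega> n = {v. Lmode Y \<omega> 0 v = scale (of_int n) v}"

locale vertex_operator_algebra =
  vector_space scale
  for scale :: "complex \<Rightarrow> 'v::ab_group_add \<Rightarrow> 'v"
    and Y :: "'v \<Rightarrow> int \<Rightarrow> 'v \<Rightarrow> 'v"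
    and vac :: 'v
    and \<omega> :: 'v +
  assumes mode_linear: "Vector_Spaces.linear scale scale (Y v n)"
    and state_linear: "Vector_Spaces.linear scale scale (\<lambda>v. Y v n w)"
    and truncation: "\<exists>N. \<forall>n\<ge>N. Y v n w = 0"
    and vacuum: "Y vac n w = (if n = -1 then w else 0)"
    and creation: "n \<ge> 0 \<Longrightarrow> Y v n vac = 0" "Y v (-1) vac = v"
    and jacobi: "jacobi_identity Y scale Y"
    and virasoro: "\<exists>c. \<forall>m n w.
          Lmode Y \<omega> m (Lmode Y \<omega> n w) - Lmode Y \<omega> n (Lmode Y \<omega> m w)
          = scale (of_int (m - n)) (Lmode Y \<omega> (m + n) w)
            + scale (if m + n = 0 then of_int (m ^ 3 - m) / 12 * c else 0) w"
    and L_minus_one_derivative: "Y (Lmode Y \<omega> (-1) v) n w = scale (- of_int n) (Y v (n - 1) w)"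
    and grading: "is_direct_sum scale UNIV (weight_space scale Y \<omega>)"
    and weight_space_finite_dimensional: "finite_dimensional scale (weight_space scale Y \<omega> n)"
    and grading_bounded_below: "\<exists>N. \<forall>n<N. weight_space scale Y \<omega> n = {0}"

definition cft_type ::
    "(complex \<Rightarrow> 'v::ab_group_add \<Rightarrow> 'v) \<Rightarrow> ('v \<Rightarrow> int \<Rightarrow> 'v \<Rightarrow> 'v) \<Rightarrow> 'v \<Rightarrow> 'v \<Rightarrow> bool" where
  "cft_type scale Y vac \<omega> \<longleftrightarrow>
     is_direct_sum scale {0..} (weight_space scale Y \<omega>) \<and>
     weight_space scale Y \<omega> 0 = module.span scale {vac}"

definition C2_space ::
    "(complex \<Rightarrow> 'v::ab_group_add \<Rightarrow> 'v) \<Rightarrow> ('v \<Rightarrow> int \<Rightarrow> 'v \<Rightarrow> 'v) \<Rightarrow> 'v set" where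
  "C2_space scale Y = module.span scale {Y v (-2) w | v w. True}"

definition C2_cofinite ::
    "(complex \<Rightarrow> 'v::ab_group_add \<Rightarrow> 'v) \<Rightarrow> ('v \<Rightarrow> int \<Rightarrow> 'v \<Rightarrow> 'v) \<Rightarrow> bool" where
  "C2_cofinite scale Y \<longleftrightarrow> finite_dimensional_quotient scale (C2_space scale Y)"

locale weak_module =
  V: vertex_operator_algebra scaleV Y vac \<omega> + M: vector_space scaleM
  for scaleV :: "complex \<Rightarrow> 'v::ab_group_add \<Rightarrow> 'v"
    and Y :: "'v \<Rightarrow> int \<Rightarrow> 'v \<Rightarrow> 'v"
    and vac :: 'v
    and \<omega> :: 'v
    and scaleM :: "complex \<Rightarrow> 'm::ab_group_add \<Rightarrow> 'm"
    and YM :: "'v \<Rightarrow> int \<Rightarrow> 'm \<Rightarrow> 'm" +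
  assumes module_mode_linear: "Vector_Spaces.linear scaleM scaleM (YM v n)"
    and module_state_linear: "Vector_Spaces.linear scaleV scaleM (\<lambda>v. YM v n w)"
    and module_truncation: "\<exists>N. \<forall>n\<ge>N. YM v n w = 0"
    and module_vacuum: "YM vac n w = (if n = -1 then w else 0)"
    and module_jacobi: "jacobi_identity Y scaleM YM"

locale ordinary_module =
  weak_module scaleV Y vac \<omega> scaleM YM
  for scaleV :: "complex \<Rightarrow> 'v::ab_group_add \<Rightarrow> 'v"
    and Y :: "'v \<Rightarrow> int \<Rightarrow> 'v \<Rightarrow> 'v"
    and vac :: 'v
    and \<omega> :: 'v
    and scaleM :: "complex \<Rightarrow> 'm::ab_group_add \<Rightarrow> 'm"
    and YM :: "'v \<Rightarrow> int \<Rightarrow> 'm \<Rightarrow> 'm" +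
  assumes module_grading: "\<exists>W :: complex \<Rightarrow> 'm set.
     is_direct_sum scaleM UNIV W \<and>
     (\<forall>r. finite_dimensional scaleM (W r)) \<and>
     (\<forall>r. \<exists>N::int. \<forall>n<N. W (r + of_int n) = {0}) \<and>
     (\<forall>r. \<forall>w \<in> W r. Lmode YM \<omega> 0 w = scaleM r w)"

definition submodule ::
    "(complex \<Rightarrow> 'm::ab_group_add \<Rightarrow> 'm) \<Rightarrow> ('v \<Rightarrow> int \<Rightarrow> 'm \<Rightarrow> 'm) \<Rightarrow> 'm set \<Rightarrow> bool" where
  "submodule scaleM YM N \<longleftrightarrow>
     module.subspace scaleM N \<and> (\<forall>v n. \<forall>w \<in> N. YM v n w \<in> N)"

definition irreducible_action ::
    "(complex \<Rightarrow> 'm::ab_group_add \<Rightarrow> 'm) \<Rightarrow> ('v \<Rightarrow> int \<Rightarrow> 'm \<Rightarrow> 'm) \<Rightarrow> bool" where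
  "irreducible_action scaleM YM \<longleftrightarrow>
     (UNIV :: 'm set) \<noteq> {0} \<and> (\<forall>N. submodule scaleM YM N \<longrightarrow> N = {0} \<or> N = UNIV)"

locale irreducible_weak_module =
  weak_module scaleV Y vac \<omega> scaleM YM
  for scaleV :: "complex \<Rightarrow> 'v::ab_group_add \<Rightarrow> 'v"
    and Y :: "'v \<Rightarrow> int \<Rightarrow> 'v \<Rightarrow> 'v"
    and vac :: 'v
    and \<omega> :: 'v
    and scaleM :: "complex \<Rightarrow> 'm::ab_group_add \<Rightarrow> 'm"
    and YM :: "'v \<Rightarrow> int \<Rightarrow> 'm \<Rightarrow> 'm" +
  assumes irreducible: "irreducible_action scaleM YM"

text \<open>A submodule of an ordinary module is stable under \<open>L(0)\<close>, hence graded, so irreducibility of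
  an ordinary module does not depend on whether submodules are required to be graded.\<close>

locale irreducible_ordinary_module =
  ordinary_module scaleV Y vac \<omega> scaleM YM
  for scaleV :: "complex \<Rightarrow> 'v::ab_group_add \<Rightarrow> 'v"
    and Y :: "'v \<Rightarrow> int \<Rightarrow> 'v \<Rightarrow> 'v"
    and vac :: 'v
    and \<omega> :: 'v
    and scaleM :: "complex \<Rightarrow> 'm::ab_group_add \<Rightarrow> 'm"
    and YM :: "'v \<Rightarrow> int \<Rightarrow> 'm \<Rightarrow> 'm" +
  assumes irreducible: "irreducible_action scaleM YM"

end

theory Submission
  imports Defs "HOL-Computational_Algebra.Fundamental_Theorem_Algebra"
begin

text \<open>
  Call \<open>a\<^sub>n\<close> with \<open>a\<close> of weight \<open>k\<close> a mode of degree \<open>k - n - 1\<close>. Filter \<open>V\<close> by the total weight of the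
  factors \<open>a\<close> in monomials in negative modes \<open>a\<^sub>-\<^sub>n\<^sub>-\<^sub>1\<close> applied to the vacuum. Modulo lower
  filtration steps the modes commute, factors of large weight vanish by \<open>C\<^sub>2\<close>-cofiniteness, and a
  repeated index can be removed by merging \<open>x\<^sub>-\<^sub>n\<^sub>-\<^sub>1 y\<^sub>-\<^sub>n\<^sub>-\<^sub>1\<close> into a mode of \<open>x\<^sub>-\<^sub>1 y\<close>. A monomial of
  large weight with factors of bounded weight and distinct indices has a large index, so for every
  \<open>m\<close> all vectors of large weight lie in the span of \<open>x\<^sub>-\<^sub>n\<^sub>-\<^sub>1 b\<close> with \<open>n \<ge> m\<close> and \<open>x\<close> of weight at most a
  fixed \<open>N0\<close>.

  Now let \<open>w\<close> be a vector of a weak module and let \<open>p\<close> be such that \<open>x\<^sub>j w = 0\<close> for \<open>j \<ge> p\<close> and all \<open>x\<close>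
  of weight at most \<open>N0\<close>. Associativity with this \<open>p\<close> expresses the degree \<open>d\<close> mode of \<open>x\<^sub>-\<^sub>n\<^sub>-\<^sub>1 b\<close> on
  \<open>w\<close> through degree \<open>d\<close> modes of vectors of smaller weight and through modes of \<open>b\<close> of degree at most
  \<open>d + p - n\<close>. Hence the span of all degree \<open>d\<close> modes on \<open>w\<close> is finite-dimensional and is zero for
  \<open>d\<close> sufficiently negative. The degree zero span is stable under \<open>L(0)\<close> and contains an eigenvector;
  the spans obtained from that eigenvector form the required grading of an irreducible module.
\<close>

section \<open>Borcherds identity on weak modules\<close>

context weak_module
begin

lemma hom_mode: "module_hom scaleM scaleM (YM v n)"
  using module_mode_linear by (simp add: linear_iff_module_hom)

lemma hom_state: "module_hom scaleV scaleM (\<lambda>v. YM v n w)"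
  using module_state_linear by (simp add: linear_iff_module_hom)

lemmas mode_simps = module_hom.add[OF hom_mode] module_hom.scale[OF hom_mode]
  module_hom.diff[OF hom_mode] module_hom.sum[OF hom_mode]
lemmas state_simps = module_hom.add[OF hom_state] module_hom.scale[OF hom_state]
  module_hom.diff[OF hom_state] module_hom.sum[OF hom_state]
lemma mode_zero [simp]: "YM v n 0 = 0" "YM 0 n w = 0"
  using module_hom.zero[OF hom_mode] module_hom.zero[OF hom_state] .

lemma mode_in_span:
  assumes "w \<in> M.span A" "M.subspace S" "\<And>a. a \<in> A \<Longrightarrow> YM v n a \<in> S"
  shows "YM v n w \<in> S"
proof -
  have "w \<in> {w. YM v n w \<in> S}"
    by (rule M.span_induct[OF assms(1)])
      (use assms in \<open>auto simp: M.subspace_def mode_simps\<close>)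
  then show ?thesis by simp
qed

lemma state_in_span:
  assumes "v \<in> V.span A" "M.subspace S" "\<And>a. a \<in> A \<Longrightarrow> YM a n w \<in> S"
  shows "YM v n w \<in> S"
proof -
  have "v \<in> {v. YM v n w \<in> S}"
    by (rule V.span_induct[OF assms(1)])
      (use assms in \<open>auto simp: M.subspace_def V.subspace_def state_simps\<close>)
  then show ?thesis by simp
qed

end

text \<open>Each sum in a coefficient of the Jacobi identity is supported on a half-line of index
  pairs, which \<open>h\<close> parametrises, and truncation cuts it off at
  \<open>N\<close>.\<close>

lemma Sum_any_reindex_nat:
  fixes h :: "nat \<Rightarrow> 'i"
  assumes "inj h" "\<And>x. x \<notin> range h \<Longrightarrow> g x = 0" "\<And>j. j \<ge> N \<Longrightarrow> g (h j) = 0"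
  shows "Sum_any g = (\<Sum>j<N. g (h j))"
proof -
  have "Sum_any g = sum g (h ` {..<N})"
  proof (rule Sum_any.expand_superset)
    show "{a. g a \<noteq> 0} \<subseteq> h ` {..<N}"
      using assms(2,3) by (auto simp: image_iff) (metis not_le lessThan_iff rangeE)
  qed simp
  also have "\<dots> = (\<Sum>j<N. g (h j))"
    by (subst sum.reindex) (use assms(1) in \<open>auto intro: inj_on_subset\<close>)
  finally show ?thesis .
qed

context weak_module
begin

text \<open>Component form of the Jacobi identity: the three delta functions contribute binomial
  coefficients, and a common \<open>N\<close> makes all three sums finite.\<close>

lemma borcherds_identity:
  fixes p q r :: int and N :: nat
  assumes uv: "\<forall>j\<ge>N. Y u (r + int j) v = 0"
    and vw: "\<forall>j\<ge>N. YM v (q + int j) w = 0"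
    and uw: "\<forall>j\<ge>N. YM u (p + int j) w = 0"
  shows "(\<Sum>j<N. scaleM (of_int p gchoose j) (YM (Y u (r + int j) v) (p + q - int j) w)) =
    (\<Sum>j<N. scaleM ((-1) ^ j * (of_int r gchoose j)) (YM u (p + r - int j) (YM v (q + int j) w)))
    - (\<Sum>j<N. scaleM ((-1) powi r * ((-1) ^ j * (of_int r gchoose j)))
        (YM v (q + r - int j) (YM u (p + int j) w)))"
proof -
  \<comment> \<open>The identity is the coefficient of
    \<open>z0^(-r-1) z1^(-p-1) z2^(-q-1)\<close>.\<close>
  let ?a = "- r - 1" and ?b = "- p - 1" and ?c = "- q - 1"
  let ?f1 = "\<lambda>(m, n). scaleM (delta_12_0 ?a (?b + m + 1) (?c + n + 1)) (YM u m (YM v n w))"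
  let ?f2 = "\<lambda>(m, n). scaleM (delta_21_0 ?a (?b + m + 1) (?c + n + 1)) (YM v n (YM u m w))"
  let ?f3 = "\<lambda>(l, n). scaleM (delta_10_2 (?a + l + 1) ?b (?c + n + 1)) (YM (Y u l v) n w)"
  have J: "Sum_any ?f1 - Sum_any ?f2 = Sum_any ?f3"
    using module_jacobi unfolding jacobi_identity_def by blast
  have S1: "Sum_any ?f1 = (\<Sum>j<N. ?f1 (p + r - int j, q + int j))"
  proof (rule Sum_any_reindex_nat)
    fix x assume x: "x \<notin> range (\<lambda>j. (p + r - int j, q + int j))"
    obtain m n where [simp]: "x = (m, n)" by force
    show "?f1 x = 0"
    proof (cases "n - q \<ge> 0 \<and> m + n = p + q + r")
      case True
      then have "x = (p + r - int (nat (n - q)), q + int (nat (n - q)))" by auto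
      then show ?thesis using x by blast
    qed (auto simp: delta_12_0_def diff_power_coeff_def)
  qed (use vw in \<open>auto simp: inj_on_def\<close>)
  have S2: "Sum_any ?f2 = (\<Sum>j<N. ?f2 (p + int j, q + r - int j))"
  proof (rule Sum_any_reindex_nat)
    fix x assume x: "x \<notin> range (\<lambda>j. (p + int j, q + r - int j))"
    obtain m n where [simp]: "x = (m, n)" by force
    show "?f2 x = 0"
    proof (cases "m - p \<ge> 0 \<and> m + n = p + q + r")
      case True
      then have "x = (p + int (nat (m - p)), q + r - int (nat (m - p)))" by auto
      then show ?thesis using x by blast
    qed (auto simp: delta_21_0_def diff_power_coeff_def)
  qed (use uw in \<open>auto simp: inj_on_def\<close>)
  have S3: "Sum_any ?f3 = (\<Sum>j<N. ?f3 (r + int j, p + q - int j))"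
  proof (rule Sum_any_reindex_nat)
    fix x assume x: "x \<notin> range (\<lambda>j. (r + int j, p + q - int j))"
    obtain m n where [simp]: "x = (m, n)" by force
    show "?f3 x = 0"
    proof (cases "m - r \<ge> 0 \<and> m + n = p + q + r")
      case True
      then have "x = (r + int (nat (m - r)), p + q - int (nat (m - r)))" by auto
      then show ?thesis using x by blast
    qed (auto simp: delta_10_2_def diff_power_coeff_def)
  qed (use uv in \<open>auto simp: inj_on_def\<close>)
  have T1: "?f1 (p + r - int j, q + int j) =
      scaleM ((-1) ^ j * (of_int r gchoose j)) (YM u (p + r - int j) (YM v (q + int j) w))" for j
    by (simp add: delta_12_0_def diff_power_coeff_def)
  have T2: "?f2 (p + int j, q + r - int j) =
      scaleM ((-1) powi r * ((-1) ^ j * (of_int r gchoose j)))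
        (YM v (q + r - int j) (YM u (p + int j) w))" for j
    by (simp add: delta_21_0_def diff_power_coeff_def)
  have T3: "?f3 (r + int j, p + q - int j) =
      scaleM (of_int p gchoose j) (YM (Y u (r + int j) v) (p + q - int j) w)" for j
    by (simp add: delta_10_2_def diff_power_coeff_def gbinomial_negated_upper[of "of_int p"])
  show ?thesis using J unfolding S1 S2 S3 T1 T2 T3 by simp
qed

text \<open>The extra bound \<open>B\<close> lets a later argument force a prescribed index into the
  range of summation.\<close>

lemma uniform_truncation:
  fixes p q r :: int
  obtains N :: nat where "N > 0" "N \<ge> B"
    "\<forall>j\<ge>N. Y u (r + int j) v = 0"
    "\<forall>j\<ge>N. YM v (q + int j) w = 0"
    "\<forall>j\<ge>N. YM u (p + int j) w = 0"
proof -
  obtain N1 N2 N3 where "\<forall>n\<ge>N1. Y u n v = 0" "\<forall>n\<ge>N2. YM v n w = 0" "\<forall>n\<ge>N3. YM u n w = 0"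
    using V.truncation module_truncation by meson
  then show thesis
    by (intro that[of "nat (\<bar>N1\<bar> + \<bar>N2\<bar> + \<bar>N3\<bar> + \<bar>p\<bar> + \<bar>q\<bar> + \<bar>r\<bar>) + B + 1"]) auto
qed

section \<open>Commutator, iterate and associativity formulas; translation and
  \<open>L(0)\<close>\<close>

lemma gchoose_0: "((0::complex) gchoose j) = (if j = 0 then 1 else 0)"
  by (cases j) auto

text \<open>The case \<open>r = 0\<close>: on the side of the products only \<open>j = 0\<close>
  survives.\<close>

lemma commutator_formula:
  obtains N :: nat where "N \<ge> B" "N > 0"
    "YM u p (YM v q w) - YM v q (YM u p w) =
      (\<Sum>j<N. scaleM (of_int p gchoose j) (YM (Y u (int j) v) (p + q - int j) w))"
proof -
  obtain N where N: "N > 0" "N \<ge> B"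
    "\<forall>j\<ge>N. Y u (0 + int j) v = 0"
    "\<forall>j\<ge>N. YM v (q + int j) w = 0"
    "\<forall>j\<ge>N. YM u (p + int j) w = 0"
    using uniform_truncation by metis
  have *: "(\<Sum>j<N. f j) = f 0" if "\<And>j. j > 0 \<Longrightarrow> f j = 0" for f :: "nat \<Rightarrow> 'm"
    by (subst sum.mono_neutral_right[of _ "{0}"]) (use that N(1) in auto)
  show thesis
    using borcherds_identity[OF N(3-5)] N(1,2)
    by (intro that[of N]) (simp_all add: * gchoose_0)
qed

lemma iterate_formula:
  obtains N :: nat where "N \<ge> B" "N > 0"
    "YM (Y u r v) q w =
      (\<Sum>j<N. scaleM ((-1) ^ j * (of_int r gchoose j)) (YM u (r - int j) (YM v (q + int j) w)))
      - (\<Sum>j<N. scaleM ((-1) powi r * ((-1) ^ j * (of_int r gchoose j)))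
        (YM v (q + r - int j) (YM u (int j) w)))"
proof -
  obtain N where N: "N > 0" "N \<ge> B"
    "\<forall>j\<ge>N. Y u (r + int j) v = 0"
    "\<forall>j\<ge>N. YM v (q + int j) w = 0"
    "\<forall>j\<ge>N. YM u (0 + int j) w = 0"
    using uniform_truncation by metis
  have *: "(\<Sum>j<N. f j) = f 0" if "\<And>j. j > 0 \<Longrightarrow> f j = 0" for f :: "nat \<Rightarrow> 'm"
    by (subst sum.mono_neutral_right[of _ "{0}"]) (use that N(1) in auto)
  show thesis
    using borcherds_identity[OF N(3-5)] N(1,2)
    by (intro that[of N]) (simp_all add: * gchoose_0)
qed

text \<open>The bound \<open>p\<close> annihilates the sum in which \<open>u\<close> acts first on
  \<open>w\<close>.\<close>

lemma associativity_formula: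
  assumes "\<And>n. n \<ge> p \<Longrightarrow> YM u n w = 0"
  obtains N :: nat where "N > 0"
    "(\<Sum>j<N. scaleM (of_int p gchoose j) (YM (Y u (r + int j) v) (p + q - int j) w)) =
     (\<Sum>j<N. scaleM ((-1) ^ j * (of_int r gchoose j)) (YM u (p + r - int j) (YM v (q + int j) w)))"
proof -
  obtain N where N: "N > 0" "N \<ge> 0"
    "\<forall>j\<ge>N. Y u (r + int j) v = 0"
    "\<forall>j\<ge>N. YM v (q + int j) w = 0"
    "\<forall>j\<ge>N. YM u (p + int j) w = 0"
    using uniform_truncation by metis
  show thesis
    using borcherds_identity[OF N(3-5)] N(1) assms
    by (intro that[of N]) simp_all
qed

text \<open>The derivative rule on \<open>M\<close> comes from \<open>L(-1) u = u_(-2) vac\<close>,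
  a consequence of creation and the derivative rule in \<open>V\<close>, by expanding the modes of
  \<open>u_(-2) vac\<close> with the iterate formula.\<close>

lemma translation_mode: "YM (Lmode Y \<omega> (-1) u) n w = scaleM (- of_int n) (YM u (n - 1) w)"
proof -
  have "Lmode Y \<omega> (-1) u = Y (Lmode Y \<omega> (-1) u) (-1) vac"
    by (simp add: V.creation)
  also have "\<dots> = Y u (-2) vac"
    by (simp add: V.L_minus_one_derivative)
  finally have *: "Lmode Y \<omega> (-1) u = Y u (-2) vac" .
  have g: "(-1) ^ j * ((-2::complex) gchoose j) = of_nat j + 1" for j
  proof -
    have "(-1) ^ j * ((-2::complex) gchoose j) = of_nat (Suc j) gchoose j"
      by (subst gbinomial_negated_upper) simp
    also have "\<dots> = of_nat j + 1"
      unfolding binomial_gbinomial[symmetric] by simp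
    finally show ?thesis .
  qed
  obtain N where N: "N \<ge> nat \<bar>n\<bar> + 1" "N > 0" "YM (Y u (-2) vac) n w =
      (\<Sum>j<N. scaleM ((-1) ^ j * (of_int (-2) gchoose j)) (YM u (-2 - int j) (YM vac (n + int j) w)))
      - (\<Sum>j<N. scaleM ((-1) powi (-2) * ((-1) ^ j * (of_int (-2) gchoose j)))
        (YM vac (n + (-2) - int j) (YM u (int j) w)))"
    by (rule iterate_formula)
  \<comment> \<open>Only \<open>vac_(-1)\<close> is nonzero, so at most one index survives:
    \<open>j = -n-1\<close> here, for negative \<open>n\<close>, and \<open>j = n-1\<close> in the
    other sum, for positive \<open>n\<close>. The bound on \<open>N\<close> puts it in
    range.\<close>
  have A: "(\<Sum>j<N. scaleM ((-1) ^ j * (of_int (-2) gchoose j)) (YM u (-2 - int j) (YM vac (n + int j) w)))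
     = (if n < 0 then scaleM (- of_int n) (YM u (n - 1) w) else 0)" (is "?L = ?R")
  proof -
    have "?L = (\<Sum>j<N. if j = nat (- n - 1) then (if n < 0 then scaleM (- of_int n) (YM u (n - 1) w) else 0) else 0)"
      by (intro sum.cong) (auto simp: V.vacuum module_vacuum g)
    also have "\<dots> = ?R"
      using N(1,2) by (subst sum.delta) auto
    finally show ?thesis .
  qed
  have B: "(\<Sum>j<N. scaleM ((-1) powi (-2) * ((-1) ^ j * (of_int (-2) gchoose j)))
        (YM vac (n + (-2) - int j) (YM u (int j) w)))
     = (if n > 0 then scaleM (of_int n) (YM u (n - 1) w) else 0)" (is "?L = ?R")
  proof -
    have "?L = (\<Sum>j<N. if j = nat (n - 1) then (if n > 0 then scaleM (of_int n) (YM u (n - 1) w) else 0) else 0)"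
      by (intro sum.cong) (auto simp: module_vacuum g)
    also have "\<dots> = ?R"
      using N(1,2) by (subst sum.delta) auto
    finally show ?thesis .
  qed
  show ?thesis unfolding * N(3) A B by auto
qed

text \<open>Since \<open>L(0)\<close> is the mode \<open>1\<close> of \<open>\<omega>\<close>, the
  binomials \<open>gchoose\<close> of \<open>1\<close> leave two terms of the commutator formula,
  modes of \<open>L(-1) u\<close> and of \<open>L(0) u\<close>.\<close>

lemma Lzero_commutator:
  assumes "u \<in> weight_space scaleV Y \<omega> k"
  shows "Lmode YM \<omega> 0 (YM u n w) = YM u n (Lmode YM \<omega> 0 w) + scaleM (of_int (k - n - 1)) (YM u n w)"
proof -
  obtain N where N: "N \<ge> 2" "N > 0"
    "YM \<omega> 1 (YM u n w) - YM u n (YM \<omega> 1 w) =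
      (\<Sum>j<N. scaleM (of_int 1 gchoose j) (YM (Y \<omega> (int j) u) (1 + n - int j) w))"
    by (rule commutator_formula)
  have "(\<Sum>j<N. scaleM (of_int 1 gchoose j) (YM (Y \<omega> (int j) u) (1 + n - int j) w))
    = (\<Sum>j<2. scaleM (of_int 1 gchoose j) (YM (Y \<omega> (int j) u) (1 + n - int j) w))"
  proof (rule sum.mono_neutral_right)
    have "(1::complex) gchoose j = 0" if "j \<ge> 2" for j
      using that binomial_gbinomial[of 1 j, where ?'a=complex] by (simp add: binomial_eq_0)
    then show "\<forall>j\<in>{..<N} - {..<2}. scaleM (of_int 1 gchoose j) (YM (Y \<omega> (int j) u) (1 + n - int j) w) = 0"
      by simp
  qed (use N(1) in auto)
  also have "\<dots> = YM (Lmode Y \<omega> (-1) u) (1 + n) w + YM (Lmode Y \<omega> 0 u) n w"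
    by (simp add: numeral_2_eq_2 Lmode_def)
  also have "\<dots> = scaleM (of_int (k - n - 1)) (YM u n w)"
    using assms unfolding translation_mode weight_space_def
    by (simp add: state_simps flip: M.scale_left_distrib)
  finally show ?thesis using N(3) by (simp add: Lmode_def algebra_simps)
qed

end

section \<open>Weights and the filtration by monomials\<close>

lemma in_direct_sum:
  assumes "is_direct_sum scale I W"
  shows "\<exists>!f. finite {i. f i \<noteq> 0} \<and> (\<forall>i\<in>I. f i \<in> W i) \<and> (\<forall>i. i \<notin> I \<longrightarrow> f i = 0) \<and> x = Sum_any f"
  using assms unfolding is_direct_sum_def by (elim conjE allE)

text \<open>The adjoint module: identities proved for weak modules become available on
  \<open>V\<close> itself under the prefix \<open>adj\<close>.\<close>

sublocale vertex_operator_algebra \<subseteq> adj: weak_module scale Y vac \<omega> scale Y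
proof (intro weak_module.intro weak_module_axioms.intro)
  show "vertex_operator_algebra scale Y vac \<omega>" "vector_space scale"
    by (fact vertex_operator_algebra_axioms vector_space_axioms)+
qed (fact mode_linear state_linear truncation vacuum jacobi)+

context vertex_operator_algebra
begin

abbreviation "wt \<equiv> weight_space scale Y \<omega>"

lemma subspace_wt: "subspace (wt n)"
  using grading unfolding is_direct_sum_def by simp

lemma mode_wt:
  assumes "a \<in> wt i" "b \<in> wt j"
  shows "Y a n b \<in> wt (i + j - n - 1)"
  using adj.Lzero_commutator[OF assms(1), of n b] assms(2)
  by (simp add: weight_space_def adj.mode_simps flip: scale_left_distrib)

lemma vac_wt: "vac \<in> wt 0"
  by (simp add: weight_space_def Lmode_def creation)

text \<open>The relation \<open>[L(0), L(-2)] = 2 L(-2)\<close> applied to the vacuum, where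
  \<open>L(-2) vac = \<omega>\<close> and \<open>L(0) vac = 0\<close>.\<close>

lemma omega_wt: "\<omega> \<in> wt 2"
proof -
  obtain c where "\<forall>m n w.
          Lmode Y \<omega> m (Lmode Y \<omega> n w) - Lmode Y \<omega> n (Lmode Y \<omega> m w)
          = scale (of_int (m - n)) (Lmode Y \<omega> (m + n) w)
            + scale (if m + n = 0 then of_int (m ^ 3 - m) / 12 * c else 0) w"
    using virasoro by blast
  from this[rule_format, of 0 "-2" vac] show ?thesis
    by (simp add: weight_space_def Lmode_def creation)
qed

definition component :: "'v \<Rightarrow> int \<Rightarrow> 'v" where
  "component v = (THE f. finite {i. f i \<noteq> 0} \<and> (\<forall>i. f i \<in> wt i) \<and> v = Sum_any f)"

lemma ex1_component: "\<exists>!f. finite {i. f i \<noteq> 0} \<and> (\<forall>i. f i \<in> wt i) \<and> v = Sum_any f"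
  using in_direct_sum[OF grading, of v] by simp

lemma component_eqI:
  "finite {i. f i \<noteq> 0} \<Longrightarrow> (\<And>i. f i \<in> wt i) \<Longrightarrow> v = Sum_any f \<Longrightarrow> component v = f"
  unfolding component_def by (rule the1_equality[OF ex1_component]) auto

lemma component:
  "finite {i. component v i \<noteq> 0}" "component v i \<in> wt i" "Sum_any (component v) = v"
  using theI'[OF ex1_component[of v]] unfolding component_def by auto

lemma component_homogeneous:
  assumes "v \<in> wt k"
  shows "component v = (\<lambda>i. if i = k then v else 0)"
proof (rule component_eqI)
  show "(if i = k then v else 0) \<in> wt i" for i
    using assms subspace_0[OF subspace_wt] by simp
qed (use finite_subset[of _ "{k}"] in auto)

lemma component_hom: "module_hom scale scale (\<lambda>v. component v i)"
proof unfold_locales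
  fix x y :: 'v and r :: complex
  have "component (x + y) = (\<lambda>i. component x i + component y i)"
  proof (rule component_eqI)
    show "finite {i. component x i + component y i \<noteq> 0}"
      by (rule finite_subset[OF _ finite_UnI[OF component(1)[of x] component(1)[of y]]]) auto
  qed (auto simp: component subspace_add[OF subspace_wt] Sum_any.distrib)
  then show "component (x + y) i = component x i + component y i" by simp
  have fin: "finite {i. scale r (component x i) \<noteq> 0}"
    by (rule finite_subset[OF _ component(1)[of x]]) auto
  have "component (scale r x) = (\<lambda>i. scale r (component x i))"
  proof (rule component_eqI[OF fin])
    have "scale r x = scale r (\<Sum>i | component x i \<noteq> 0. component x i)"
      using component(3)[of x] by (simp add: Sum_any.expand_set)
    also have "\<dots> = (\<Sum>i | component x i \<noteq> 0. scale r (component x i))"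
      by (rule scale_sum_right)
    also have "\<dots> = (\<Sum>i. scale r (component x i))"
      by (rule Sum_any.expand_superset[symmetric]) (auto simp: component)
    finally show "scale r x = (\<Sum>i. scale r (component x i))" .
  qed (auto simp: component subspace_scale[OF subspace_wt])
  then show "component (scale r x) i = scale r (component x i)" by simp
qed

text \<open>A triple \<open>(k, a, n)\<close> stands for the mode \<open>a\<^sub>-\<^sub>n\<^sub>-\<^sub>1\<close> of a vector \<open>a\<close> of weight \<open>k\<close>; it raises the
  weight by \<open>k + n\<close>.\<close>

definition letters :: "(nat \<times> 'v \<times> nat) list \<Rightarrow> bool" where
  "letters xs \<longleftrightarrow> (\<forall>(k, a, n) \<in> set xs. a \<in> wt (int k))"

fun app :: "(nat \<times> 'v \<times> nat) list \<Rightarrow> 'v \<Rightarrow> 'v" where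
  "app [] b = b"
| "app ((k, a, n) # xs) b = Y a (- int n - 1) (app xs b)"

abbreviation "mon xs \<equiv> app xs vac"

definition psize :: "(nat \<times> 'v \<times> nat) list \<Rightarrow> nat" where
  "psize xs = (\<Sum>(k, a, n) \<leftarrow> xs. k)"

definition hsize :: "(nat \<times> 'v \<times> nat) list \<Rightarrow> nat" where
  "hsize xs = (\<Sum>(k, a, n) \<leftarrow> xs. k + n)"

lemma size_simps [simp]:
  "psize [] = 0" "psize ((k, a, n) # xs) = k + psize xs" "psize (xs @ ys) = psize xs + psize ys"
  "hsize [] = 0" "hsize ((k, a, n) # xs) = k + n + hsize xs" "hsize (xs @ ys) = hsize xs + hsize ys"
  by (simp_all add: psize_def hsize_def)

lemma letters_simps [simp]:
  "letters []" "letters ((k, a, n) # xs) \<longleftrightarrow> a \<in> wt (int k) \<and> letters xs"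
  "letters (xs @ ys) \<longleftrightarrow> letters xs \<and> letters ys"
  by (simp_all add: letters_def ball_Un)

lemma app_append: "app (xs @ ys) b = app xs (app ys b)"
  by (induction xs) auto

lemma app_diff: "app xs (b - c) = app xs b - app xs c"
  by (induction xs) (auto simp: adj.mode_simps)

lemma app_wt: "letters xs \<Longrightarrow> b \<in> wt h \<Longrightarrow> app xs b \<in> wt (int (hsize xs) + h)"
proof (induction xs)
  case (Cons l xs)
  obtain k a n where [simp]: "l = (k, a, n)" by (cases l)
  show ?case
    using mode_wt[of a "int k" "app xs b" "int (hsize xs) + h" "- int n - 1"] Cons
    by (simp add: algebra_simps)
qed auto

lemma mono_wt: "letters xs \<Longrightarrow> mon xs \<in> wt (int (hsize xs))"
  using app_wt[OF _ vac_wt] by simp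

text \<open>With the strict bound, \<open>filt h 0\<close> is zero, and \<open>filt h p\<close>
  consists of the terms of lower order for a monomial of size \<open>p\<close>.\<close>

definition filt :: "int \<Rightarrow> nat \<Rightarrow> 'v set" where
  "filt h p = span {mon xs | xs. letters xs \<and> psize xs < p \<and> int (hsize xs) = h}"

lemma subspace_filt [simp]: "subspace (filt h p)"
  by (simp add: filt_def subspace_span)

lemmas filt_closed [simp, intro] = subspace_0[OF subspace_filt] subspace_add[OF subspace_filt]
  subspace_diff[OF subspace_filt] subspace_sum[OF subspace_filt] subspace_scale[OF subspace_filt]

lemma filt_mono: "p \<le> p' \<Longrightarrow> filt h p \<subseteq> filt h p'"
  unfolding filt_def by (rule span_mono) auto

lemma mono_in_filt: "letters xs \<Longrightarrow> psize xs < p \<Longrightarrow> int (hsize xs) = h \<Longrightarrow> mon xs \<in> filt h p"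
  unfolding filt_def by (rule span_base) auto

lemma filt_letter:
  assumes "a \<in> wt (int k)" "b \<in> filt h q"
  shows "Y a (- int n - 1) b \<in> filt (h + int k + int n) (k + q)"
  using assms(2) unfolding filt_def[of h q]
proof (rule adj.mode_in_span)
  fix x assume "x \<in> {mon xs |xs. letters xs \<and> psize xs < q \<and> int (hsize xs) = h}"
  then obtain xs where "x = mon xs" "letters xs" "psize xs < q" "int (hsize xs) = h" by auto
  then show "Y a (- int n - 1) x \<in> filt (h + int k + int n) (k + q)"
    using mono_in_filt[of "(k, a, n) # xs"] assms(1) by simp
qed simp

lemma filt_app: "letters xs \<Longrightarrow> b \<in> filt h q \<Longrightarrow> app xs b \<in> filt (h + int (hsize xs)) (q + psize xs)"
proof (induction xs)
  case (Cons l xs)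
  obtain k a n where [simp]: "l = (k, a, n)" by (cases l)
  show ?case
    using filt_letter[of a k "app xs b" "h + int (hsize xs)" "q + psize xs" n] Cons
    by (simp add: algebra_simps)
qed auto

text \<open>Target of the reduction. The weight of \<open>b\<close> is an integer expression, so no
  constraint \<open>k + n \<le> h\<close> is built in.\<close>

definition deep :: "nat \<Rightarrow> nat \<Rightarrow> nat \<Rightarrow> 'v set" where
  "deep N0 m h = span {Y x (- int n - 1) b | x b k n.
     x \<in> wt (int k) \<and> k \<le> N0 \<and> n \<ge> m \<and> b \<in> wt (int h - int k - int n)}"

text \<open>Increases when two equal indices are replaced by different ones with the same sum; this makes
  the removal of repeated indices terminate.\<close>

definition ssq :: "(nat \<times> 'v \<times> nat) list \<Rightarrow> nat" where
  "ssq xs = (\<Sum>(k, a, n) \<leftarrow> xs. n * n)"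

lemma ssq_simps [simp]:
  "ssq [] = 0" "ssq ((k, a, n) # xs) = n * n + ssq xs" "ssq (xs @ ys) = ssq xs + ssq ys"
  by (simp_all add: ssq_def)

text \<open>This bound turns the growth of \<open>ssq\<close> at fixed weight into a decreasing
  natural number.\<close>

lemma ssq_le: "ssq xs \<le> hsize xs * hsize xs"
proof (induction xs)
  case (Cons l xs)
  obtain k a n where [simp]: "l = (k, a, n)" by (cases l)
  show ?case using Cons by (simp add: algebra_simps)
qed simp

lemma app_sum: "app xs (\<Sum>i\<in>A. f i) = (\<Sum>i\<in>A. app xs (f i))"
  by (induction xs) (auto simp: adj.mode_simps)

end

section \<open>Nonnegative weights: modes and the filtration\<close>

locale nonneg_graded_voa = vertex_operator_algebra scale Y vac \<omega>
  for scale :: "complex \<Rightarrow> 'v::ab_group_add \<Rightarrow> 'v"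
    and Y :: "'v \<Rightarrow> int \<Rightarrow> 'v \<Rightarrow> 'v"
    and vac :: 'v
    and \<omega> :: 'v +
  assumes nonneg_grading: "is_direct_sum scale {0..} (weight_space scale Y \<omega>)"
begin

text \<open>A decomposition over nonnegative weights is also one over all weights, and the latter is
  unique.\<close>

lemma nonneg_component: "i < 0 \<Longrightarrow> component v i = 0"
proof -
  assume i: "i < 0"
  obtain f where f: "finite {i. f i \<noteq> 0}" "\<forall>i\<in>{0..}. f i \<in> wt i" "\<forall>i. i \<notin> {0..} \<longrightarrow> f i = 0"
    "v = Sum_any f"
    using ex1_implies_ex[OF in_direct_sum[OF nonneg_grading, of v]] by blast
  have "component v = f"
  proof (rule component_eqI)
    show "f i \<in> wt i" for i
      using f(2,3) subspace_0[OF subspace_wt] by (cases "i \<ge> 0") auto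
  qed (use f in auto)
  then show ?thesis using f(3) i by simp
qed

lemma negative_wt: "v \<in> wt n \<Longrightarrow> n < 0 \<Longrightarrow> v = 0"
  using component_homogeneous[of v n] nonneg_component[of n v] by simp

lemma homogeneous_span: "v \<in> span (\<Union>k. wt (int k))"
proof -
  have "v = (\<Sum>i | component v i \<noteq> 0. component v i)"
    using component(3)[of v] by (simp add: Sum_any.expand_set)
  also have "\<dots> \<in> span (\<Union>k. wt (int k))"
  proof (intro span_sum)
    fix i assume "i \<in> {i. component v i \<noteq> 0}"
    then have "i \<ge> 0" using nonneg_component[of i v] by force
    then have "component v i \<in> wt (int (nat i))" by (simp add: component)
    then show "component v i \<in> span (\<Union>k. wt (int k))" by (intro span_base) blast
  qed
  finally show ?thesis .
qed

text \<open>A nonnegative mode gains one filtration step over a letter. It kills the vacuum, and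
  commuting it past a letter \<open>c\<close> produces modes of \<open>a_i c\<close> with
  \<open>i \<ge> 0\<close>, whose weight is below the sum of the weights of \<open>a\<close> and
  \<open>c\<close>.\<close>

lemma nonneg_mode_mon:
  "a \<in> wt (int k) \<Longrightarrow> letters xs \<Longrightarrow>
    Y a (int j) (mon xs) \<in> filt (int (hsize xs) + int k - int j - 1) (k + psize xs)"
proof (induction xs arbitrary: a k j)
  case Nil
  then show ?case by (simp add: creation)
next
  case (Cons l xs)
  obtain kc c n where l [simp]: "l = (kc, c, n)" by (cases l)
  have c: "c \<in> wt (int kc)" and xs: "letters xs" using Cons.prems by auto
  define F where "F = filt (int (hsize (l # xs)) + int k - int j - 1) (k + psize (l # xs))"
  obtain N :: nat where N: "N \<ge> 0" "N > 0" "Y a (int j) (Y c (- int n - 1) (mon xs)) - Y c (- int n - 1) (Y a (int j) (mon xs)) =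
      (\<Sum>i<N. scale (of_int (int j) gchoose i) (Y (Y a (int i) c) (int j + (- int n - 1) - int i) (mon xs)))"
    by (rule adj.commutator_formula)
  have "Y (Y a (int i) c) (int j + (- int n - 1) - int i) (mon xs) \<in> F" for i
  proof -
    define s where "s = int j + (- int n - 1) - int i"
    have e: "Y a (int i) c \<in> wt (int k + int kc - int i - 1)"
      by (rule mode_wt[OF Cons.prems(1) c])
    show ?thesis
    proof (cases "int k + int kc - int i - 1 < 0")
      case True
      then show ?thesis using negative_wt[OF e] by (simp add: F_def)
    next
      case False
      define k' where "k' = nat (int k + int kc - int i - 1)"
      have e': "Y a (int i) c \<in> wt (int k')" and k': "k' < k + kc"
        using e False by (auto simp: k'_def)
      show ?thesis
      \<comment> \<open>A nonnegative mode of \<open>a_i c\<close> is again covered by the induction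
        hypothesis, which is why \<open>a\<close>, \<open>k\<close> and \<open>j\<close> are
        generalised; a negative mode is just a new letter.\<close>
      proof (cases "s \<ge> 0")
        case True
        then have "Y (Y a (int i) c) (int (nat s)) (mon xs)
            \<in> filt (int (hsize xs) + int k' - int (nat s) - 1) (k' + psize xs)"
          by (intro Cons.IH e' xs)
        moreover have *: "int (hsize xs) + int k' - int (nat s) - 1 = int (hsize (l # xs)) + int k - int j - 1"
          using False True by (simp add: k'_def s_def)
        moreover have "filt (int (hsize xs) + int k' - int (nat s) - 1) (k' + psize xs) \<subseteq> F"
          unfolding F_def * using k' by (intro filt_mono) simp
        ultimately have "Y (Y a (int i) c) (int (nat s)) (mon xs) \<in> F" by blast
        then show ?thesis using True by (simp add: s_def)
      next
        case neg: False
        have "mon ((k', Y a (int i) c, nat (- s - 1)) # xs) \<in> F"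
          unfolding F_def using e' xs k' False neg
          by (intro mono_in_filt) (auto simp: k'_def s_def)
        moreover have "- int (nat (- s - 1)) - 1 = s" using neg by simp
        ultimately show ?thesis by (simp flip: s_def)
      qed
    qed
  qed
  then have "(\<Sum>i<N. scale (of_int (int j) gchoose i) (Y (Y a (int i) c) (int j + (- int n - 1) - int i) (mon xs))) \<in> F"
    unfolding F_def by (intro filt_closed)
  moreover have "Y c (- int n - 1) (Y a (int j) (mon xs)) \<in> F"
    using filt_letter[OF c Cons.IH[OF Cons.prems(1) xs, of j], of n] by (simp add: F_def algebra_simps)
  ultimately have "Y a (int j) (Y c (- int n - 1) (mon xs)) \<in> F"
    unfolding N(3)[unfolded diff_eq_eq] unfolding F_def by (rule filt_closed(2))
  then show ?case by (simp add: F_def)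
qed

lemma filt_nonneg_mode:
  assumes "a \<in> wt (int k)" "b \<in> filt h (Suc q)"
  shows "Y a (int j) b \<in> filt (h + int k - int j - 1) (k + q)"
  using assms(2) unfolding filt_def[of h]
proof (rule adj.mode_in_span)
  fix x assume "x \<in> {mon xs |xs. letters xs \<and> psize xs < Suc q \<and> int (hsize xs) = h}"
  then obtain xs where "x = mon xs" "letters xs" "psize xs < Suc q" "int (hsize xs) = h" by auto
  then show "Y a (int j) x \<in> filt (h + int k - int j - 1) (k + q)"
    using nonneg_mode_mon[OF assms(1), of xs j] filt_mono[of "k + psize xs" "k + q"] by auto
qed simp

lemma filt_mode:
  assumes "a \<in> wt (int k)" "b \<in> filt h q"
  shows "Y a s b \<in> filt (h + int k - s - 1) (k + q)"
proof (cases "s \<ge> 0")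
  case True
  have "b \<in> filt h (Suc q)" using assms(2) filt_mono[of q "Suc q" h] by auto
  then show ?thesis using filt_nonneg_mode[OF assms(1), of b h q "nat s"] True by simp
next
  case False
  then show ?thesis using filt_letter[OF assms, of "nat (- s - 1)"] by (simp add: algebra_simps)
qed

lemma filt_product_mode:
  assumes "a \<in> wt (int k)" "c \<in> wt (int l)" "b \<in> filt h (Suc q)"
  shows "Y (Y a (int i) c) s b \<in> filt (h + int k + int l - int i - s - 2) (k + l + q)"
proof -
  have e: "Y a (int i) c \<in> wt (int k + int l - int i - 1)"
    by (rule mode_wt[OF assms(1,2)])
  show ?thesis
  proof (cases "int k + int l - int i - 1 < 0")
    case True
    then show ?thesis using negative_wt[OF e] by simp
  next
    case False
    define k' where "k' = nat (int k + int l - int i - 1)"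
    have e': "Y a (int i) c \<in> wt (int k')" and k': "k' + Suc q \<le> k + l + q"
      using e False by (auto simp: k'_def)
    have eq: "h + int k' - s - 1 = h + int k + int l - int i - s - 2" using False by (simp add: k'_def)
    show ?thesis
      using subsetD[OF filt_mono[OF k'] filt_mode[OF e' assms(3), of s]] unfolding eq .
  qed
qed

text \<open>Modes commute modulo lower filtration: the commutator formula involves only products
  \<open>a_i c\<close> with \<open>i \<ge> 0\<close>, which lose at least one unit of
  weight.\<close>

lemma filt_commutator:
  assumes "a \<in> wt (int k)" "c \<in> wt (int l)" "b \<in> filt h (Suc q)"
  shows "Y a s (Y c t b) - Y c t (Y a s b) \<in> filt (h + int k + int l - s - t - 2) (k + l + q)"
proof -
  obtain N :: nat where N: "N \<ge> 0" "N > 0" "Y a s (Y c t b) - Y c t (Y a s b) =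
      (\<Sum>i<N. scale (of_int s gchoose i) (Y (Y a (int i) c) (s + t - int i) b))"
    by (rule adj.commutator_formula)
  have "h + int k + int l - int i - (s + t - int i) - 2 = h + int k + int l - s - t - 2" for i by simp
  then show ?thesis
    unfolding N(3) using filt_product_mode[OF assms] by (intro filt_closed) metis
qed

lemma filt_move:
  assumes "letters xs" "a \<in> wt (int k)" "b \<in> filt h (Suc q)"
  shows "app xs (Y a (- int n - 1) b) - Y a (- int n - 1) (app xs b)
    \<in> filt (h + int (hsize xs) + int k + int n) (q + psize xs + k)"
  using assms(1)
proof (induction xs)
  case (Cons l xs)
  obtain kc c t where [simp]: "l = (kc, c, t)" by (cases l)
  have c: "c \<in> wt (int kc)" and xs: "letters xs" using Cons.prems by auto
  let ?A = "Y a (- int n - 1)" and ?C = "Y c (- int t - 1)"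
  have 1: "?C (app xs (?A b) - ?A (app xs b))
      \<in> filt (h + int (hsize (l # xs)) + int k + int n) (q + psize (l # xs) + k)"
    using filt_letter[OF c Cons.IH[OF xs], of t] by (simp add: algebra_simps)
  have "app xs b \<in> filt (h + int (hsize xs)) (Suc (q + psize xs))"
    using filt_app[OF xs assms(3)] by simp
  from filt_commutator[OF c assms(2) this, of "- int t - 1" "- int n - 1"]
  have 2: "?C (?A (app xs b)) - ?A (?C (app xs b))
      \<in> filt (h + int (hsize (l # xs)) + int k + int n) (q + psize (l # xs) + k)"
    by (simp add: algebra_simps)
  show ?case using filt_closed(2)[OF 1 2] by (simp add: adj.mode_simps)
qed simp

text \<open>For \<open>N = 2n\<close> this rewrites the monomial with index \<open>n\<close> repeated.\<close>

lemma filt_merge: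
  assumes x: "x \<in> wt (int k)" and y: "y \<in> wt (int l)" and b: "b \<in> filt h (Suc q)"
  shows "Y (Y x (-1) y) (- int N - 1) b
      - (\<Sum>i\<le>N. Y x (- int i - 1) (Y y (- int (N - i) - 1) b))
    \<in> filt (h + int k + int l + int N) (k + l + q)" (is "_ \<in> ?F")
proof -
  have g: "(-1) ^ j * (of_int (-1) gchoose j) = (1::complex)" for j
    by (subst gbinomial_negated_upper) (simp add: binomial_gbinomial[symmetric])
  obtain J where J: "J \<ge> Suc N" "J > 0" "Y (Y x (-1) y) (- int N - 1) b =
      (\<Sum>j<J. scale ((-1) ^ j * (of_int (-1) gchoose j)) (Y x (-1 - int j) (Y y (- int N - 1 + int j) b)))
      - (\<Sum>j<J. scale ((-1) powi (-1) * ((-1) ^ j * (of_int (-1) gchoose j)))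
        (Y y (- int N - 1 + (-1) - int j) (Y x (int j) b)))"
    by (rule adj.iterate_formula)
  let ?t = "\<lambda>j. Y x (-1 - int j) (Y y (- int N - 1 + int j) b)"
  let ?R = "\<Sum>j<J. scale ((-1) powi (-1) * ((-1) ^ j * (of_int (-1) gchoose j)))
        (Y y (- int N - 1 + (-1) - int j) (Y x (int j) b))"
  \<comment> \<open>Here a nonnegative mode of \<open>x\<close> acts on \<open>b\<close> first,
    which gains one filtration step.\<close>
  have "?R \<in> ?F"
  proof (intro filt_closed)
    fix j
    show "Y y (- int N - 1 + (-1) - int j) (Y x (int j) b) \<in> ?F"
      using filt_mode[OF y filt_nonneg_mode[OF x b, of j], of "- int N - 1 + (-1) - int j"]
      by (simp add: algebra_simps)
  qed
  \<comment> \<open>For \<open>j > N\<close> the mode of \<open>y\<close> is nonnegative, with the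
    same gain.\<close>
  moreover have "(\<Sum>j\<in>{..<J} - {..N}. ?t j) \<in> ?F"
  proof (intro filt_closed)
    fix j assume "j \<in> {..<J} - {..N}"
    then have j: "- int N - 1 + int j = int (j - N - 1)" by auto
    show "?t j \<in> ?F"
      using filt_mode[OF x filt_nonneg_mode[OF y b, of "j - N - 1"], of "-1 - int j"]
      unfolding j[symmetric] by (simp add: algebra_simps)
  qed
  moreover have "(\<Sum>j<J. ?t j) = (\<Sum>j\<in>{..<J} - {..N}. ?t j) + (\<Sum>j\<le>N. ?t j)"
    using J(1) by (intro sum.subset_diff) auto
  moreover have "(\<Sum>j\<le>N. ?t j) = (\<Sum>i\<le>N. Y x (- int i - 1) (Y y (- int (N - i) - 1) b))"
  proof (rule sum.cong[OF refl])
    fix i assume "i \<in> {..N}"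
    then have "-1 - int i = - int i - 1" "- int N - 1 + int i = - int (N - i) - 1" by auto
    then show "?t i = Y x (- int i - 1) (Y y (- int (N - i) - 1) b)" by metis
  qed
  moreover have "Y (Y x (-1) y) (- int N - 1) b = (\<Sum>j<J. ?t j) - ?R"
    using J(3) unfolding g by simp
  ultimately have "Y (Y x (-1) y) (- int N - 1) b
      - (\<Sum>i\<le>N. Y x (- int i - 1) (Y y (- int (N - i) - 1) b)) = (\<Sum>j\<in>{..<J} - {..N}. ?t j) - ?R"
    by simp
  also have "\<dots> \<in> ?F" by (rule filt_closed) fact+
  finally show ?thesis .
qed

section \<open>Reduction of vectors of large weight\<close>

context
  fixes N0 :: nat
  assumes C2: "\<And>h x. h > N0 \<Longrightarrow> x \<in> wt (int h) \<Longrightarrow>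
    x \<in> span {Y c (-2) d | c d k l. c \<in> wt (int k) \<and> d \<in> wt (int l) \<and> k + l + 1 = h}"
begin

text \<open>A heavy vector is a combination of \<open>c_(-2) d\<close> with weights adding up to
  \<open>k - 1\<close>. The iterate formula splits its modes into products of modes of
  \<open>c\<close> and \<open>d\<close>, so the filtration rises by less than for a letter of weight
  \<open>k\<close>.\<close>

lemma filt_C2:
  assumes "a \<in> wt (int k)" "k > N0" "b \<in> filt h (Suc q)"
  shows "Y a s b \<in> filt (h + int k - s - 1) (k + q)" (is "_ \<in> ?F")
  using C2[OF assms(2,1)]
proof (rule adj.state_in_span)
  fix x assume "x \<in> {Y c (-2) d | c d k' l. c \<in> wt (int k') \<and> d \<in> wt (int l) \<and> k' + l + 1 = k}"
  then obtain c d k' l where x: "x = Y c (-2) d" and c: "c \<in> wt (int k')" and d: "d \<in> wt (int l)"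
    and k: "k = k' + l + 1" by auto
  obtain N where N: "N \<ge> 0" "N > 0" "Y (Y c (-2) d) s b =
      (\<Sum>j<N. scale ((-1) ^ j * (of_int (-2) gchoose j)) (Y c (-2 - int j) (Y d (s + int j) b)))
      - (\<Sum>j<N. scale ((-1) powi (-2) * ((-1) ^ j * (of_int (-2) gchoose j)))
        (Y d (s + (-2) - int j) (Y c (int j) b)))"
    by (rule adj.iterate_formula)
  have "Y c (-2 - int j) (Y d (s + int j) b) \<in> ?F" for j
    using filt_mode[OF c filt_mode[OF d assms(3)], of "-2 - int j" "s + int j"]
    by (simp add: k algebra_simps)
  moreover have "Y d (s + (-2) - int j) (Y c (int j) b) \<in> ?F" for j
    using filt_mode[OF d filt_mode[OF c assms(3)], of "s + (-2) - int j" "int j"]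
    by (simp add: k algebra_simps)
  ultimately show "Y x s b \<in> ?F"
    unfolding x N(3) by (intro filt_closed)
qed simp

text \<open>A monomial with a heavy letter is of lower order, one with a deep letter lies in
  \<open>deep\<close> up to lower order, and any other repeats an index, which is removed by
  merging.\<close>

lemma mon_reduce:
  assumes S: "subspace S" and lower: "filt (int h) p \<subseteq> S" and deep: "deep N0 m h \<subseteq> S"
    and h: "h > m * (N0 + m)"
  shows "letters xs \<Longrightarrow> psize xs = p \<Longrightarrow> hsize xs = h \<Longrightarrow> mon xs \<in> S"
\<comment> \<open>The measure orders first by the number of letters and then by
  \<open>h * h - ssq xs\<close>; the factor \<open>h * h + 1\<close> exceeds every value of the
  second summand.\<close>
proof (induction "length xs * (h * h + 1) + (h * h - ssq xs)" arbitrary: xs rule: less_induct)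
  case less
  note SS = subspace_diff[OF S] subspace_add[OF S] subspace_sum[OF S]
  consider (high) k a n where "(k, a, n) \<in> set xs" "k > N0"
    | (deep) k a n where "(k, a, n) \<in> set xs" "k \<le> N0" "n \<ge> m"
    | (repeat) "\<forall>(k, a, n) \<in> set xs. k \<le> N0 \<and> n < m"
    by (force simp: not_less not_le)
  then show ?case
  proof cases
    case high
    then obtain A B where xs: "xs = A @ (k, a, n) # B" by (meson split_list)
    have "mon B \<in> filt (int (hsize B)) (Suc (psize B))"
      using less.prems xs by (intro mono_in_filt) auto
    then have "Y a (- int n - 1) (mon B) \<in> filt (int (hsize B) + int k - (- int n - 1) - 1) (k + psize B)"
      using less.prems high xs by (intro filt_C2) auto
    from filt_app[OF _ this, of A] have "mon xs \<in> filt (int h) p"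
      using less.prems xs by (simp add: app_append algebra_simps flip: less.prems(2,3))
    then show ?thesis using lower by auto
  next
    case deep
    then obtain A B where xs: "xs = A @ (k, a, n) # B" by (meson split_list)
    have "mon B \<in> filt (int (hsize B)) (Suc (psize B))"
      using less.prems xs by (intro mono_in_filt) auto
    \<comment> \<open>Bringing the deep letter to the front costs only terms of lower order.\<close>
    from filt_move[OF _ _ this, of A a k n]
    have "mon xs - Y a (- int n - 1) (mon (A @ B)) \<in> filt (int h) p"
      using less.prems xs by (simp add: app_append algebra_simps flip: less.prems(2,3))
    moreover have "Y a (- int n - 1) (mon (A @ B)) \<in> deep N0 m h"
      unfolding deep_def
    proof (rule span_base)
      have "mon (A @ B) \<in> wt (int h - int k - int n)"
        using mono_wt[of "A @ B"] less.prems xs by (simp add: algebra_simps flip: less.prems(2,3))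
      then show "Y a (- int n - 1) (mon (A @ B)) \<in> {Y x (- int n - 1) b | x b k n.
          x \<in> wt (int k) \<and> k \<le> N0 \<and> n \<ge> m \<and> b \<in> wt (int h - int k - int n)}"
        using deep less.prems xs by auto
    qed
    ultimately show ?thesis
      using lower assms(3) SS(2)[of "mon xs - Y a (- int n - 1) (mon (A @ B))" "Y a (- int n - 1) (mon (A @ B))"]
      by auto
  next
    case repeat
    \<comment> \<open>Distinct indices below \<open>m\<close> would bound the weight by \<open>m * (N0 + m)\<close>.\<close>
    let ?n = "\<lambda>l :: nat \<times> 'v \<times> nat. snd (snd l)"
    have "hsize ys \<le> length ys * (N0 + m)" if "set ys \<subseteq> set xs" for ys
      using that repeat by (induction ys) (auto simp: algebra_simps)
    from this[of xs] have "h \<le> length xs * (N0 + m)"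
      using less.prems(3) by simp
    with h have "m * (N0 + m) < length xs * (N0 + m)" by (rule less_le_trans)
    then have len: "m < length xs" unfolding mult_less_cancel2 by simp
    have "\<not> distinct (map ?n xs)"
    proof
      assume "distinct (map ?n xs)"
      then have "length xs = card (set (map ?n xs))" by (metis distinct_card length_map)
      also have "\<dots> \<le> card {..<m}"
        using repeat by (intro card_mono) auto
      finally show False using len by simp
    qed
    then obtain ws ys zs n where "map ?n xs = ws @ [n] @ ys @ [n] @ zs"
      using not_distinct_decomp by blast
    then obtain A B C k x l y where xs: "xs = A @ (k, x, n) # B @ (l, y, n) # C"
      by (auto simp: map_eq_append_conv map_eq_Cons_conv append_eq_map_conv Cons_eq_map_conv)
    have x: "x \<in> wt (int k)" and y: "y \<in> wt (int l)" and L: "letters A" "letters B" "letters C"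
      using less.prems xs by auto
    have p: "p = psize A + psize B + psize C + k + l" and hh: "h = hsize A + hsize B + hsize C + k + l + 2 * n"
      using less.prems xs by auto
    let ?X = "\<lambda>i. Y x (- int i - 1)" and ?Y = "\<lambda>i. Y y (- int i - 1)"
    define c where "c = mon (B @ C)"
    have c: "c \<in> filt (int (hsize B + hsize C)) (Suc (psize B + psize C))"
      unfolding c_def using L by (intro mono_in_filt) auto
    have "mon C \<in> filt (int (hsize C)) (Suc (psize C))"
      using L by (intro mono_in_filt) auto
    \<comment> \<open>Modulo lower order, the second letter of index \<open>n\<close> is moved
      across \<open>B\<close> to stand next to the first.\<close>
    from filt_move[OF L(2) y this, of n]
    have "app B (?Y n (mon C)) - ?Y n c \<in> filt (int (hsize B + hsize C + l + n)) (psize B + psize C + l)"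
      by (simp add: c_def app_append algebra_simps)
    from filt_app[OF L(1) filt_letter[OF x this, of n]]
    have 1: "mon xs - app A (?X n (?Y n c)) \<in> filt (int h) p"
      by (simp add: xs app_append app_diff adj.mode_simps p hh algebra_simps)
    let ?z = "Y x (-1) y"
    have z: "?z \<in> wt (int (k + l))" using mode_wt[OF x y, of "-1"] by simp
    \<comment> \<open>The summand \<open>i = n\<close> on the right is the monomial in question; all
      other terms are smaller in the measure.\<close>
    from filt_app[OF L(1) filt_merge[OF x y c, of "2 * n"]]
    have 2: "app A (Y ?z (- int (2 * n) - 1) c)
       - (\<Sum>i\<le>2 * n. app A (?X i (?Y (2 * n - i) c))) \<in> filt (int h) p"
      by (simp add: app_diff app_sum p hh algebra_simps)
    \<comment> \<open>The merged monomial has the same size and weight but one letter fewer, which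
      outweighs any change of \<open>ssq\<close>.\<close>
    have "mon (A @ (k + l, ?z, 2 * n) # B @ C) \<in> S"
    proof (rule less.hyps)
      have "Suc (length (A @ B @ C)) * (h * h + 1) + h * h < Suc (Suc (length (A @ B @ C))) * (h * h + 1)"
        by simp
      then show "length (A @ (k + l, ?z, 2 * n) # B @ C) * (h * h + 1)
          + (h * h - ssq (A @ (k + l, ?z, 2 * n) # B @ C)) < length xs * (h * h + 1) + (h * h - ssq xs)"
        by (simp add: xs)
    qed (use L z p hh in auto)
    then have 3: "app A (Y ?z (- int (2 * n) - 1) c) \<in> S"
      by (simp add: app_append c_def)
    \<comment> \<open>The number of letters is unchanged, but \<open>ssq\<close> grows, because the
      squares of \<open>i\<close> and \<open>2 * n - i\<close> sum to \<open>2 * n * n\<close> plus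
      twice the square of \<open>i - n\<close>.\<close>
    have 4: "app A (?X i (?Y (2 * n - i) c)) \<in> S" if i: "i \<in> {..2 * n} - {n}" for i
    proof -
      define j where "j = 2 * n - i"
      have "mon (A @ (k, x, i) # (l, y, j) # B @ C) \<in> S"
      proof (rule less.hyps)
        let ?xs = "A @ (k, x, i) # (l, y, j) # B @ C"
        have "int i * int i + int j * int j = 2 * (int n * int n) + 2 * ((int i - int n) * (int i - int n))"
          using i by (simp add: j_def of_nat_diff algebra_simps)
        moreover have "(int i - int n) * (int i - int n) > 0"
          using i by (simp add: zero_less_mult_iff) linarith
        ultimately have "int (n * n + n * n) < int (i * i + j * j)" unfolding of_nat_add of_nat_mult by linarith
        then have "n * n + n * n < i * i + j * j" by (simp only: of_nat_less_iff)
        then have "ssq xs < ssq ?xs" by (simp add: xs)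
        moreover have "hsize ?xs = h" using i hh by (simp add: j_def)
        then have "ssq ?xs \<le> h * h" using ssq_le[of ?xs] by simp
        ultimately show "length ?xs * (h * h + 1) + (h * h - ssq ?xs) < length xs * (h * h + 1) + (h * h - ssq xs)"
          by (simp add: xs)
      qed (use L x y p hh i in \<open>auto simp: j_def\<close>)
      then show ?thesis by (simp add: app_append c_def j_def)
    qed
    have "(\<Sum>i\<le>2 * n. app A (?X i (?Y (2 * n - i) c)))
      = app A (?X n (?Y n c)) + (\<Sum>i\<in>{..2 * n} - {n}. app A (?X i (?Y (2 * n - i) c)))"
      by (subst sum.remove[of _ n]) auto
    then have "mon xs = (mon xs - app A (?X n (?Y n c))) - (app A (Y ?z (- int (2 * n) - 1) c)
       - (\<Sum>i\<le>2 * n. app A (?X i (?Y (2 * n - i) c)))) + app A (Y ?z (- int (2 * n) - 1) c)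
       - (\<Sum>i\<in>{..2 * n} - {n}. app A (?X i (?Y (2 * n - i) c)))"
      by simp
    also have "\<dots> \<in> S"
      by (rule SS(1)[OF SS(2)[OF SS(1)[OF subsetD[OF lower 1] subsetD[OF lower 2]] 3] SS(3)[OF 4]])
    finally show ?thesis .
  qed
qed

text \<open>By induction on \<open>p\<close> every filtration step of weight \<open>h\<close> lies
  in \<open>deep\<close>, and \<open>x = x_(-1) vac\<close> is a monomial with one letter.\<close>

lemma weight_in_deep:
  assumes "h > m * (N0 + m)" "x \<in> wt (int h)"
  shows "x \<in> deep N0 m h"
proof -
  have sub: "subspace (deep N0 m h)" unfolding deep_def by (rule subspace_span)
  have "filt (int h) p \<subseteq> deep N0 m h" for p
  proof (induction p)
    case 0
    have "filt (int h) 0 = {0}" by (simp add: filt_def)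
    then show ?case using subspace_0[OF sub] by simp
  next
    case (Suc p)
    have "mon xs \<in> deep N0 m h" if "letters xs" "psize xs < Suc p" "hsize xs = h" for xs
    proof (cases "psize xs = p")
      case True
      then show ?thesis using mon_reduce[OF sub Suc order_refl assms(1)] that by simp
    next
      case False
      then have "mon xs \<in> filt (int h) p" using that by (intro mono_in_filt) auto
      then show ?thesis using Suc by auto
    qed
    then show ?case unfolding filt_def[of _ "Suc p"] by (intro span_minimal sub) auto
  qed
  moreover have "mon [(h, x, 0)] \<in> filt (int h) (Suc h)"
    using assms(2) by (intro mono_in_filt) auto
  moreover have "mon [(h, x, 0)] = x" by (simp add: creation)
  ultimately show ?thesis by (metis subsetD)
qed

end

section \<open>Homogeneous form of \<open>C_2\<close>-cofiniteness\<close>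

lemma C2_homogeneous_span:
  "C2_space scale Y \<subseteq> span (\<Union>k l. {Y c (-2) d | c d. c \<in> wt (int k) \<and> d \<in> wt (int l)})"
  (is "_ \<subseteq> span ?G")
  unfolding C2_space_def
proof (rule span_minimal[OF subsetI subspace_span])
  fix x assume "x \<in> {Y v (-2) w |v w. True}"
  then obtain v w where x: "x = Y v (-2) w" by auto
  show "x \<in> span ?G"
    unfolding x
  proof (rule adj.state_in_span[OF homogeneous_span subspace_span])
    fix a assume a: "a \<in> (\<Union>k. wt (int k))"
    show "Y a (-2) w \<in> span ?G"
    proof (rule adj.mode_in_span[OF homogeneous_span subspace_span])
      fix b assume "b \<in> (\<Union>k. wt (int k))"
      then show "Y a (-2) b \<in> span ?G"
        using a by (intro span_base) blast
    qed
  qed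
qed

text \<open>Above all weights occurring in a finite set spanning \<open>V\<close> modulo
  \<open>C_2(V)\<close>, projection to weight \<open>h\<close> kills that set and keeps only the
  \<open>c_(-2) d\<close> of weight \<open>k + l + 1 = h\<close>.\<close>

lemma C2_cofinite_weights:
  assumes "C2_cofinite scale Y"
  obtains N0 where "\<And>h x. h > N0 \<Longrightarrow> x \<in> wt (int h) \<Longrightarrow>
    x \<in> span {Y c (-2) d | c d k l. c \<in> wt (int k) \<and> d \<in> wt (int l) \<and> k + l + 1 = h}"
proof -
  obtain B where B: "finite B" "\<And>x. \<exists>y \<in> span B. x - y \<in> C2_space scale Y"
    using assms unfolding C2_cofinite_def finite_dimensional_quotient_def by blast
  define I where "I = (\<Union>b\<in>B. {i. component b i \<noteq> 0})"
  \<comment> \<open>If \<open>I\<close> is empty, \<open>M\<close> is arbitrary, but the bound below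
    concerns only members of \<open>I\<close>.\<close>
  define M where "M = Max I"
  have "finite I" unfolding I_def using B(1) component(1) by simp
  then have M: "i \<le> M" if "i \<in> I" for i
    unfolding M_def using that by (rule Max_ge)
  show thesis
  proof (rule that[of "nat M"])
    fix h x assume h: "h > nat M" and x: "x \<in> wt (int h)"
    let ?S = "span {Y c (-2) d | c d k l. c \<in> wt (int k) \<and> d \<in> wt (int l) \<and> k + l + 1 = h}"
    interpret ch: module_hom scale scale "\<lambda>v. component v (int h)" by (rule component_hom)
    obtain y where y: "y \<in> span B" "x - y \<in> C2_space scale Y" using B(2) by blast
    have "component y (int h) = 0"
    proof (rule span_induct[OF y(1), where P = "\<lambda>v. component v (int h) = 0"])
      show "subspace {v. component v (int h) = 0}"
        by (auto simp: subspace_def ch.add ch.scale)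
      fix b assume "b \<in> B"
      moreover have "int h \<notin> I" using M[of "int h"] h by auto
      ultimately show "component b (int h) = 0" by (auto simp: I_def)
    qed
    then have "component (x - y) (int h) = x"
      using component_homogeneous[OF x] by (simp add: ch.diff)
    moreover have "component (x - y) (int h) \<in> ?S"
    proof (rule span_induct[OF subsetD[OF C2_homogeneous_span y(2)], where P = "\<lambda>v. component v (int h) \<in> ?S"])
      show "subspace {v. component v (int h) \<in> ?S}"
        by (auto simp: subspace_def ch.add ch.scale span_add span_scale span_zero)
      fix g assume "g \<in> (\<Union>k l. {Y c (-2) d | c d. c \<in> wt (int k) \<and> d \<in> wt (int l)})"
      then obtain k l c d where g: "g = Y c (-2) d" "c \<in> wt (int k)" "d \<in> wt (int l)" by auto
      have "g \<in> wt (int (k + l + 1))" using mode_wt[OF g(2,3), of "-2"] g(1) by (simp add: algebra_simps)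
      then have comp: "component g (int h) = (if h = k + l + 1 then g else 0)"
        by (simp add: component_homogeneous flip: of_nat_Suc of_nat_add)
      show "component g (int h) \<in> ?S"
      proof (cases "h = k + l + 1")
        case True
        then have "g \<in> ?S" using g by (intro span_base) blast
        then show ?thesis using comp True by simp
      next
        case False
        then show ?thesis using comp by (simp add: span_zero)
      qed
    qed
    ultimately show "x \<in> ?S" by simp
  qed
qed

end

section \<open>Eigenvectors\<close>

text \<open>Applying \<open>L - a\<close> to the sum removes the term of eigenvalue \<open>a\<close>
  and multiplies the others by the nonzero factors \<open>i - a\<close>.\<close>

lemma (in vector_space) eigenvectors_independent:
  assumes "finite A" "module_hom scale scale L"
    "\<And>i. i \<in> A \<Longrightarrow> L (h i) = scale i (h i)" "(\<Sum>i\<in>A. h i) = 0" "i \<in> A"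
  shows "h i = 0"
  using assms
proof (induction A arbitrary: h i rule: finite_induct)
  case (insert a A)
  interpret L: module_hom scale scale L by fact
  have "0 = L (\<Sum>i\<in>insert a A. h i) - scale a (\<Sum>i\<in>insert a A. h i)"
    by (simp only: insert.prems(3) L.zero scale_zero_right diff_zero)
  also have "\<dots> = (\<Sum>i\<in>insert a A. scale (i - a) (h i))"
    unfolding L.sum scale_sum_right sum_subtractf[symmetric]
    by (rule sum.cong) (simp_all only: insert.prems(2) scale_left_diff_distrib)
  also have "\<dots> = (\<Sum>i\<in>A. scale (i - a) (h i))"
    using insert.hyps by simp
  finally have sum0: "(\<Sum>i\<in>A. scale (i - a) (h i)) = 0" by simp
  have "h i = 0" if "i \<in> A" for i
  proof -
    have "scale (i - a) (h i) = 0"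
    proof (rule insert.IH[OF insert.prems(1) _ sum0 that])
      fix j assume "j \<in> A"
      then show "L (scale (j - a) (h j)) = scale j (scale (j - a) (h j))"
        using insert.prems(2)[of j] by (simp add: L.scale scale_left_commute)
    qed
    moreover have "i \<noteq> a" using that insert.hyps by auto
    ultimately show ?thesis by simp
  qed
  moreover from this have "h a = 0" using insert.prems(3) insert.hyps by simp
  ultimately show ?case using insert.prems(4) by auto
qed simp

text \<open>The vectors having a decomposition form a subspace that contains every
  \<open>W i\<close>; uniqueness is the independence of eigenvectors.\<close>

lemma is_direct_sum_eigenspaces:
  fixes scale :: "complex \<Rightarrow> 'a::ab_group_add \<Rightarrow> 'a"
  assumes "vector_space scale" "module_hom scale scale L"
    and W: "\<And>i. module.subspace scale (W i)" "\<And>i x. x \<in> W i \<Longrightarrow> L x = scale i x"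
    and spans: "\<And>x. x \<in> module.span scale (\<Union>i. W i)"
  shows "is_direct_sum scale UNIV W"
proof -
  interpret vector_space scale by fact
  interpret L: module_hom scale scale L by fact
  define E where "E = {x. \<exists>f. finite {i. f i \<noteq> 0} \<and> (\<forall>i. f i \<in> W i) \<and> x = Sum_any f}"
  have fin: "finite {i. g i \<noteq> 0}" if "finite {i. f i \<noteq> 0}" "\<And>i. f i = 0 \<Longrightarrow> g i = 0"
    for f g :: "complex \<Rightarrow> 'a"
    by (rule finite_subset[OF _ that(1)]) (use that(2) in auto)
  have fin2: "finite {i. f i \<noteq> 0 \<or> g i \<noteq> 0}" if "finite {i. f i \<noteq> 0}" "finite {i. g i \<noteq> 0}"
    for f g :: "complex \<Rightarrow> 'a"
    using finite_UnI[OF that] by (simp only: Collect_disj_eq)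
  have "subspace E"
  proof (rule subspaceI)
    show "0 \<in> E" unfolding E_def using subspace_0[OF W(1)] by (auto intro!: exI[of _ "\<lambda>_. 0"])
  next
    fix x y assume "x \<in> E" "y \<in> E"
    then obtain f g where f: "finite {i. f i \<noteq> 0}" "\<forall>i. f i \<in> W i" "x = Sum_any f"
      and g: "finite {i. g i \<noteq> 0}" "\<forall>i. g i \<in> W i" "y = Sum_any g"
      unfolding E_def by blast
    have "finite {i. f i + g i \<noteq> 0}"
      by (rule finite_subset[OF _ fin2[OF f(1) g(1)]]) auto
    then show "x + y \<in> E" unfolding E_def mem_Collect_eq
      using f g by (intro exI[of _ "\<lambda>i. f i + g i"]) (auto simp: Sum_any.distrib subspace_add[OF W(1)])
  next
    fix c x assume "x \<in> E"
    then obtain f where f: "finite {i. f i \<noteq> 0}" "\<forall>i. f i \<in> W i" "x = Sum_any f"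
      unfolding E_def by blast
    have fc: "finite {i. scale c (f i) \<noteq> 0}" by (rule fin[OF f(1)]) simp
    have "scale c x = (\<Sum>i | f i \<noteq> 0. scale c (f i))"
      by (simp add: f(3) Sum_any.expand_set scale_sum_right)
    also have "\<dots> = (\<Sum>i. scale c (f i))"
      by (rule Sum_any.expand_superset[symmetric]) (use f in auto)
    finally show "scale c x \<in> E" unfolding E_def mem_Collect_eq
      using f fc by (intro exI[of _ "\<lambda>i. scale c (f i)"]) (auto simp: subspace_scale[OF W(1)])
  qed
  moreover have "(\<Union>i. W i) \<subseteq> E"
  proof
    fix x assume "x \<in> (\<Union>i. W i)"
    then obtain k where k: "x \<in> W k" by auto
    have "finite {i. (if i = k then x else 0) \<noteq> 0}" by (rule finite_subset[of _ "{k}"]) auto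
    then show "x \<in> E" unfolding E_def mem_Collect_eq
      using k subspace_0[OF W(1)] by (intro exI[of _ "\<lambda>i. if i = k then x else 0"]) auto
  qed
  ultimately have "span (\<Union>i. W i) \<subseteq> E" by (intro span_minimal)
  then have ex: "x \<in> E" for x using spans by blast
  have unique: "f = g" if f: "finite {i. f i \<noteq> 0}" "\<forall>i. f i \<in> W i"
      and g: "finite {i. g i \<noteq> 0}" "\<forall>i. g i \<in> W i" and eq: "Sum_any f = Sum_any g" for f g
  proof
    fix i
    define A where "A = insert i {i. f i \<noteq> 0 \<or> g i \<noteq> 0}"
    have A: "finite A" unfolding A_def using fin2[OF f(1) g(1)] by simp
    have "Sum_any f = sum f A" "Sum_any g = sum g A"
      by (rule Sum_any.expand_superset[OF A]; auto simp: A_def)+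
    then have "(\<Sum>i\<in>A. f i - g i) = 0" using eq by (simp add: sum_subtractf)
    moreover have "L (f j - g j) = scale j (f j - g j)" for j
      using W(2)[of "f j" j] W(2)[of "g j" j] f(2) g(2) by (simp add: L.diff scale_right_diff_distrib)
    ultimately have "f i - g i = 0"
      by (intro eigenvectors_independent[OF A assms(2), of "\<lambda>i. f i - g i"]) (auto simp: A_def)
    then show "f i = g i" by simp
  qed
  show ?thesis
    unfolding is_direct_sum_def
  proof (intro conjI ballI allI)
    fix x
    obtain f where f: "finite {i. f i \<noteq> 0}" "\<forall>i. f i \<in> W i" "x = Sum_any f"
      using ex[of x] unfolding E_def by blast
    show "\<exists>!f. finite {i. f i \<noteq> 0} \<and> (\<forall>i\<in>UNIV. f i \<in> W i) \<and> (\<forall>i. i \<notin> UNIV \<longrightarrow> f i = 0) \<and> x = Sum_any f"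
    proof (rule ex1I[of _ f])
      fix g assume "finite {i. g i \<noteq> 0} \<and> (\<forall>i\<in>UNIV. g i \<in> W i) \<and> (\<forall>i. i \<notin> UNIV \<longrightarrow> g i = 0) \<and> x = Sum_any g"
      then show "g = f" using f by (intro unique) auto
    qed (use f in auto)
  qed (rule W(1))
qed

text \<open>Take \<open>p\<close> of least degree with \<open>p(L) w = 0\<close> and a root
  \<open>c\<close> of it. For \<open>p = (X - c) q\<close> the vector \<open>q(L) w\<close> is
  nonzero by minimality and is killed by \<open>L - c\<close>.\<close>

lemma ex_eigenvector:
  fixes scale :: "complex \<Rightarrow> 'a::ab_group_add \<Rightarrow> 'a"
  assumes "vector_space scale" "module_hom scale scale L"
    and S: "module.subspace scale S" "\<And>x. x \<in> S \<Longrightarrow> L x \<in> S"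
    and B: "finite B" "S \<subseteq> module.span scale B"
    and w: "w \<in> S" "w \<noteq> 0"
  obtains c v where "v \<in> S" "v \<noteq> 0" "L v = scale c v"
proof -
  interpret vector_space scale by fact
  interpret L: module_hom scale scale L by fact
  define f where "f i = (L ^^ i) w" for i
  have f0: "f 0 = w" and fSuc: "L (f i) = f (Suc i)" for i by (simp_all add: f_def)
  have fS: "f i \<in> S" for i by (induction i) (simp_all add: f0 w S(2) flip: fSuc)
  \<comment> \<open>\<open>ev p\<close> is \<open>p(L) w\<close>.\<close>
  define ev where "ev p = (\<Sum>i\<le>degree p. scale (coeff p i) (f i))" for p
  have ev: "ev p = (\<Sum>i\<le>n. scale (coeff p i) (f i))" if "n \<ge> degree p" for p n
    unfolding ev_def using that
    by (intro sum.mono_neutral_left) (auto simp: coeff_eq_0 not_le)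
  have ev_diff: "ev (p - q) = ev p - ev q" for p q
    by (subst (1 2 3) ev[of _ "max (degree p) (degree q)"])
      (auto simp: degree_diff_le scale_left_diff_distrib sum_subtractf)
  have ev_smult: "ev (smult c p) = scale c (ev p)" for c p
    by (subst (1 2) ev[of _ "degree p"]) (auto simp: degree_smult_le scale_sum_right)
  have ev_pCons: "ev (pCons 0 p) = L (ev p)" for p
    unfolding ev[OF degree_pCons_le] sum.atMost_Suc_shift
    by (simp add: ev_def L.sum L.scale fSuc)
  have evS: "ev p \<in> S" for p
    unfolding ev_def by (intro subspace_sum[OF S(1)] subspace_scale[OF S(1)] fS)
  \<comment> \<open>Either the first \<open>card B + 1\<close> iterates are distinct, hence
    dependent, or two of them coincide and a difference of monomials serves.\<close>
  have "\<exists>p. p \<noteq> 0 \<and> ev p = 0"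
  proof (cases "inj_on f {..card B}")
    case True
    have "dependent (f ` {..card B})"
    proof (rule ccontr)
      assume "independent (f ` {..card B})"
      moreover have "f ` {..card B} \<subseteq> span B" using fS B(2) by blast
      ultimately have "card (f ` {..card B}) \<le> card B"
        using independent_span_bound[OF B(1)] by blast
      then show False using True by (simp add: card_image)
    qed
    then obtain u where u: "\<exists>i\<in>{..card B}. u (f i) \<noteq> 0" "(\<Sum>v\<in>f ` {..card B}. scale (u v) v) = 0"
      by (auto simp: dependent_finite)
    define p where "p = (\<Sum>i\<le>card B. monom (u (f i)) i)"
    have c: "coeff p i = (if i \<le> card B then u (f i) else 0)" for i
      by (auto simp: p_def coeff_sum)
    have "p \<noteq> 0" using u(1) c by (metis atMost_iff coeff_0)
    moreover have "ev p = (\<Sum>i\<le>card B. scale (u (f i)) (f i))"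
      by (subst ev[of _ "card B"]) (auto simp: c intro!: degree_le)
    moreover have "\<dots> = 0" using u(2) True by (simp add: sum.reindex)
    ultimately show ?thesis by auto
  next
    case False
    then obtain i j where ij: "i \<noteq> j" "f i = f j" by (auto simp: inj_on_def)
    have ev_monom: "ev (monom 1 n) = f n" for n
      by (subst ev[of _ n]) (auto simp: degree_monom_le if_distrib[of "\<lambda>c. scale c _"] cong: if_cong)
    have "coeff (monom 1 i - monom (1::complex) j) i \<noteq> 0" using ij by simp
    then have "monom 1 i - monom (1::complex) j \<noteq> 0" by (metis coeff_0)
    then show ?thesis using ij ev_monom ev_diff by (metis diff_self)
  qed
  then obtain p where p: "p \<noteq> 0" "ev p = 0" and min: "\<And>q. q \<noteq> 0 \<Longrightarrow> ev q = 0 \<Longrightarrow> degree p \<le> degree q"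
    using ex_has_least_nat[of "\<lambda>p. p \<noteq> 0 \<and> ev p = 0" _ degree] by metis
  have "degree p \<noteq> 0"
  proof
    assume "degree p = 0"
    then obtain c where c: "p = [:c:]" by (metis degree_eq_zeroE)
    then show False using p w(2) by (simp add: ev_def f0)
  qed
  then obtain c where "poly p c = 0"
    using fundamental_theorem_of_algebra[of p] constant_degree[of p] by auto
  then obtain q where q: "p = [:- c, 1:] * q" by (metis poly_eq_0_iff_dvd dvdE)
  have "q \<noteq> 0" using p q by auto
  then have deg: "degree p = Suc (degree q)" unfolding q by (subst degree_mult_eq) auto
  have "p = pCons 0 q - smult c q" by (simp add: q)
  then have "L (ev q) - scale c (ev q) = 0" using p(2) by (simp add: ev_diff ev_smult ev_pCons)
  moreover have "ev q \<noteq> 0" using min[OF \<open>q \<noteq> 0\<close>] deg by auto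
  ultimately show thesis using evS[of q] by (intro that[of "ev q" c]) auto
qed

section \<open>Homogeneous modes applied to a vector of a weak module\<close>

lemma ex_common_bound:
  fixes P :: "'a \<Rightarrow> int \<Rightarrow> bool"
  assumes "finite A" "\<And>a. a \<in> A \<Longrightarrow> \<exists>T. \<forall>n\<ge>T. P a n"
  shows "\<exists>T :: nat. \<forall>a\<in>A. \<forall>n\<ge>int T. P a n"
proof -
  obtain T where T: "\<And>a n. a \<in> A \<Longrightarrow> n \<ge> T a \<Longrightarrow> P a n"
    using assms(2) by metis
  show ?thesis
  proof (intro exI ballI allI impI)
    fix a n assume a: "a \<in> A" and n: "n \<ge> int (\<Sum>a\<in>A. nat (T a))"
    have "nat (T a) \<le> (\<Sum>a\<in>A. nat (T a))"
      using assms(1) a by (intro member_le_sum) auto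
    moreover have "T a \<le> int (nat (T a))" by simp
    ultimately have "T a \<le> n" using n by linarith
    then show "P a n" by (rule T[OF a])
  qed
qed

context weak_module
begin

text \<open>Finitely many finite-dimensional weight spaces are involved, so truncation on spanning
  sets gives one bound for all.\<close>

lemma weight_space_truncation:
  "\<exists>T :: nat. \<forall>k\<le>H. \<forall>u\<in>V.wt (int k). \<forall>n\<ge>int T. YM u n w = 0"
proof -
  have "\<exists>T. \<forall>n\<ge>T. \<forall>u\<in>V.wt (int k). YM u n w = 0" for k
  proof -
    obtain B where B: "finite B" "V.span B = V.wt (int k)"
      using V.weight_space_finite_dimensional unfolding finite_dimensional_def by blast
    obtain T :: nat where T: "\<forall>b\<in>B. \<forall>n\<ge>int T. YM b n w = 0"
      using ex_common_bound[OF B(1), of "\<lambda>b n. YM b n w = 0"] module_truncation by blast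
    have "YM u n w \<in> {0}" if "u \<in> V.wt (int k)" "n \<ge> int T" for u n
      using that(1) unfolding B(2)[symmetric]
      by (rule state_in_span) (use T that(2) in auto)
    then show ?thesis by auto
  qed
  then have "\<exists>T :: nat. \<forall>k\<in>{..H}. \<forall>n\<ge>int T. \<forall>u\<in>V.wt (int k). YM u n w = 0"
    by (intro ex_common_bound) auto
  then show ?thesis by (meson atMost_iff)
qed

text \<open>On a vector of weight \<open>k\<close> the mode of index \<open>k - 1 - d\<close> is the
  one of degree \<open>d\<close>.\<close>

definition shift :: "int \<Rightarrow> 'm \<Rightarrow> 'm set" where
  "shift d w = M.span {YM u (int k - 1 - d) w | u k. u \<in> V.wt (int k)}"

lemma subspace_shift: "M.subspace (shift d w)"
  unfolding shift_def by (rule M.subspace_span)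

lemma in_shift: "u \<in> V.wt (int k) \<Longrightarrow> n = int k - 1 - d \<Longrightarrow> YM u n w \<in> shift d w"
  unfolding shift_def by (rule M.span_base) auto

lemma self_in_shift: "w \<in> shift 0 w"
  using in_shift[of vac 0 "-1" 0 w] V.vac_wt by (simp add: module_vacuum)

end

section \<open>The span of the modes of a given degree on a vector\<close>

locale nonneg_weak_module = weak_module scaleV Y vac \<omega> scaleM YM
  for scaleV :: "complex \<Rightarrow> 'v::ab_group_add \<Rightarrow> 'v"
    and Y :: "'v \<Rightarrow> int \<Rightarrow> 'v \<Rightarrow> 'v"
    and vac :: 'v
    and \<omega> :: 'v
    and scaleM :: "complex \<Rightarrow> 'm::ab_group_add \<Rightarrow> 'm"
    and YM :: "'v \<Rightarrow> int \<Rightarrow> 'm \<Rightarrow> 'm" +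
  assumes nonneg: "nonneg_graded_voa scaleV Y vac \<omega>"
begin

interpretation N: nonneg_graded_voa scaleV Y vac \<omega> by (rule nonneg)

text \<open>Associativity rewrites \<open>a_s b_t w\<close> through single modes of the same total
  degree and products \<open>a_(s-j) b_(t+j) w\<close> with \<open>j > 0\<close>. The induction ends
  because \<open>b_t w = 0\<close> for large \<open>t\<close>.\<close>

lemma two_modes_in_shift:
  assumes a: "a \<in> V.wt (int i)" and b: "b \<in> V.wt (int k)"
  shows "YM a s (YM b t w) \<in> shift (int i + int k - 2 - s - t) w"
proof -
  obtain T where T: "\<forall>n\<ge>T. YM b n w = 0" using module_truncation by blast
  obtain p where p: "\<And>n. n \<ge> p \<Longrightarrow> YM a n w = 0" using module_truncation by blast
  have "YM a s (YM b t w) \<in> shift (int i + int k - 2 - s - t) w" if "t + int N \<ge> T" for N s t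
    using that
  proof (induction N arbitrary: s t)
    case 0
    then show ?case using T by (simp add: M.subspace_0[OF subspace_shift])
  next
    case (Suc N)
    let ?F = "shift (int i + int k - 2 - s - t) w"
    note F = M.subspace_scale[OF subspace_shift] M.subspace_sum[OF subspace_shift] M.subspace_diff[OF subspace_shift]
    \<comment> \<open>With this \<open>r\<close> the term \<open>j = 0\<close> of the products is
      \<open>a_s b_t w\<close> with coefficient one.\<close>
    define r where "r = s - p"
    obtain J where J: "J > 0"
      "(\<Sum>j<J. scaleM (of_int p gchoose j) (YM (Y a (r + int j) b) (p + t - int j) w)) =
       (\<Sum>j<J. scaleM ((-1) ^ j * (of_int r gchoose j)) (YM a (p + r - int j) (YM b (t + int j) w)))"
      by (rule associativity_formula[OF p])
    have 1: "YM (Y a (r + int j) b) (p + t - int j) w \<in> ?F" for j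
    proof -
      have wt: "Y a (r + int j) b \<in> V.wt (int i + int k - (r + int j) - 1)"
        by (rule V.mode_wt[OF a b])
      show ?thesis
      proof (cases "int i + int k - (r + int j) - 1 < 0")
        case True
        then show ?thesis using N.negative_wt[OF wt] by (simp add: M.subspace_0[OF subspace_shift])
      next
        case False
        then show ?thesis
          using wt by (intro in_shift[of _ "nat (int i + int k - (r + int j) - 1)"]) (auto simp: r_def)
      qed
    qed
    have 2: "YM a (p + r - int j) (YM b (t + int j) w) \<in> ?F" if "j > 0" for j
      using Suc.IH[of "t + int j" "p + r - int j"] Suc.prems that by (simp add: r_def algebra_simps)
    have "YM a s (YM b t w) = (\<Sum>j<J. scaleM (of_int p gchoose j) (YM (Y a (r + int j) b) (p + t - int j) w))
      - (\<Sum>j\<in>{..<J} - {0}. scaleM ((-1) ^ j * (of_int r gchoose j)) (YM a (p + r - int j) (YM b (t + int j) w)))"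
      unfolding J(2) using J(1) by (subst sum.remove[of _ 0]) (auto simp: r_def)
    also have "\<dots> \<in> ?F"
      by (rule F(3)[OF F(2)[OF F(1)[OF 1]] F(2)[OF F(1)[OF 2]]]) auto
    finally show ?case .
  qed
  from this[of t "nat (T - t)"] show ?thesis by simp
qed

lemma mode_shift:
  assumes "a \<in> V.wt (int i)" "y \<in> shift d w"
  shows "YM a s y \<in> shift (d + int i - 1 - s) w"
  using assms(2) unfolding shift_def[of d]
proof (rule mode_in_span)
  fix x assume "x \<in> {YM u (int k - 1 - d) w |u k. u \<in> V.wt (int k)}"
  then obtain u k where "x = YM u (int k - 1 - d) w" "u \<in> V.wt (int k)" by auto
  then show "YM a s x \<in> shift (d + int i - 1 - s) w"
    using two_modes_in_shift[OF assms(1), of u k s "int k - 1 - d" w] by (simp add: algebra_simps)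
qed (rule subspace_shift)

lemma Lzero_shift: "y \<in> shift d w \<Longrightarrow> Lmode YM \<omega> 0 y \<in> shift d w"
  using mode_shift[of \<omega> 2 y d w 1] V.omega_wt by (simp add: Lmode_def)

lemma shift_eigenspace:
  assumes "Lmode YM \<omega> 0 w = scaleM c w" "y \<in> shift d w"
  shows "Lmode YM \<omega> 0 y = scaleM (c + of_int d) y"
proof -
  have "y \<in> {y. Lmode YM \<omega> 0 y = scaleM (c + of_int d) y}"
    using assms(2) unfolding shift_def
  proof (rule M.span_induct)
    show "M.subspace (Collect (\<lambda>y. y \<in> {y. Lmode YM \<omega> 0 y = scaleM (c + of_int d) y}))"
      by (auto simp: M.subspace_def Lmode_def mode_simps M.scale_right_distrib M.scale_left_commute)
    fix x assume "x \<in> {YM u (int k - 1 - d) w |u k. u \<in> V.wt (int k)}"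
    then obtain u k where x: "x = YM u (int k - 1 - d) w" "u \<in> V.wt (int k)" by auto
    show "x \<in> {y. Lmode YM \<omega> 0 y = scaleM (c + of_int d) y}"
      using Lzero_commutator[OF x(2), of "int k - 1 - d" w] assms(1)
      by (simp add: x(1) mode_simps flip: M.scale_left_distrib)
  qed
  then show ?thesis by simp
qed

lemma submodule_shifts: "submodule scaleM YM (M.span (\<Union>d. shift d w))"
  unfolding submodule_def
proof (intro conjI allI ballI)
  fix v n y assume y: "y \<in> M.span (\<Union>d. shift d w)"
  show "YM v n y \<in> M.span (\<Union>d. shift d w)"
  proof (rule state_in_span[OF N.homogeneous_span M.subspace_span])
    fix a assume "a \<in> (\<Union>k. V.wt (int k))"
    then obtain i where a: "a \<in> V.wt (int i)" by auto
    show "YM a n y \<in> M.span (\<Union>d. shift d w)"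
    proof (rule mode_in_span[OF y M.subspace_span])
      fix x assume "x \<in> (\<Union>d. shift d w)"
      then obtain d where "x \<in> shift d w" by auto
      then show "YM a n x \<in> M.span (\<Union>d. shift d w)"
        using mode_shift[OF a] by (intro M.span_base) blast
    qed
  qed
qed (rule M.subspace_span)

text \<open>In the associativity formula all products vanish, since \<open>b\<close> enters with
  degree at most \<open>d + p - n\<close>. The term \<open>j = 0\<close> of the iterates is the
  wanted mode, and the others are modes of degree \<open>d\<close> of vectors of weight
  \<open>h - j\<close>.\<close>

lemma deep_mode_in_subspace:
  assumes x: "x \<in> V.wt (int k)" "\<And>n. n \<ge> int p \<Longrightarrow> YM x n w = 0"
    and b: "b \<in> V.wt (int h - int k - int n)"
    and vanish: "\<And>l d'. b \<in> V.wt (int l) \<Longrightarrow> l = h - k - n \<Longrightarrow> k + n \<le> h \<Longrightarrow>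
      d' \<le> d + int p - int n \<Longrightarrow> YM b (int l - 1 - d') w = 0"
    and S: "M.subspace S"
    and lower: "\<And>u k'. k' < h \<Longrightarrow> u \<in> V.wt (int k') \<Longrightarrow> YM u (int k' - 1 - d) w \<in> S"
  shows "YM (Y x (- int n - 1) b) (int h - 1 - d) w \<in> S"
proof (cases "k + n \<le> h")
  case False
  then have "b = 0" using N.negative_wt[OF b] by simp
  then show ?thesis by (simp add: M.subspace_0[OF S])
next
  case True
  \<comment> \<open>This makes \<open>int p + q\<close> the index of degree \<open>d\<close> in
    weight \<open>h\<close>.\<close>
  define q where "q = int h - 1 - d - int p"
  define r where "r = - int n - 1"
  obtain J where J: "J > 0"
    "(\<Sum>j<J. scaleM (of_int (int p) gchoose j) (YM (Y x (r + int j) b) (int p + q - int j) w)) =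
     (\<Sum>j<J. scaleM ((-1) ^ j * (of_int r gchoose j)) (YM x (int p + r - int j) (YM b (q + int j) w)))"
    by (rule associativity_formula[OF x(2)])
  have "YM b (q + int j) w = 0" for j
  proof -
    have "YM b (int (h - k - n) - 1 - (d + int p - int k - int n - int j)) w = 0"
    proof (rule vanish)
      have "int (h - k - n) = int h - int k - int n" using True by auto
      then show "b \<in> V.wt (int (h - k - n))" using b by metis
    qed (use True in auto)
    then show ?thesis using True by (simp add: q_def of_nat_diff algebra_simps)
  qed
  then have 0: "(\<Sum>j<J. scaleM (of_int (int p) gchoose j) (YM (Y x (r + int j) b) (int p + q - int j) w)) = 0"
    unfolding J(2) by simp
  have 1: "YM (Y x (r + int j) b) (int p + q - int j) w \<in> S" if "j > 0" for j
  proof -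
    have wt: "Y x (r + int j) b \<in> V.wt (int h - int j)"
      using V.mode_wt[OF x(1) b, of "r + int j"] by (simp add: r_def)
    show ?thesis
    proof (cases "j \<le> h")
      case True
      then show ?thesis using lower[of "h - j" "Y x (r + int j) b"] wt that
        by (simp add: of_nat_diff q_def algebra_simps)
    next
      case False
      then show ?thesis using N.negative_wt[OF wt] by (simp add: M.subspace_0[OF S])
    qed
  qed
  have "YM (Y x r b) (int p + q) w
    = - (\<Sum>j\<in>{..<J} - {0}. scaleM (of_int (int p) gchoose j) (YM (Y x (r + int j) b) (int p + q - int j) w))"
    using 0 J(1) by (subst (asm) sum.remove[of _ 0]) (auto simp: eq_neg_iff_add_eq_0)
  also have "\<dots> \<in> S"
    using 1 by (intro M.subspace_neg[OF S] M.subspace_sum[OF S] M.subspace_scale[OF S]) auto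
  also have "int p + q = int h - 1 - d" by (simp add: q_def)
  finally show ?thesis unfolding r_def .
qed

section \<open>Lower bound for the degrees and finite-dimensionality\<close>

context
  fixes N0 :: nat
  assumes deep: "\<And>m h x. h > m * (N0 + m) \<Longrightarrow> x \<in> V.wt (int h) \<Longrightarrow> x \<in> V.deep N0 m h"
begin

text \<open>Weights up to \<open>h0\<close> are handled by truncation. A heavier vector is deep, and
  its modes reduce to modes of degree at most \<open>d\<close> of vectors of smaller weight.\<close>

lemma uniform_lower_bound:
  "\<exists>K :: nat. \<forall>d < - int K. \<forall>k. \<forall>u\<in>V.wt (int k). YM u (int k - 1 - d) w = 0"
proof -
  obtain p' :: nat where p': "\<forall>k\<le>N0. \<forall>u\<in>V.wt (int k). \<forall>n\<ge>int p'. YM u n w = 0"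
    using weight_space_truncation by blast
  \<comment> \<open>The successor forces \<open>n \<ge> 1\<close>, so that \<open>b\<close> has
    weight strictly below \<open>h\<close> and the induction hypothesis applies to it.\<close>
  define p where "p = Suc p'"
  define h0 where "h0 = p * (N0 + p)"
  obtain K :: nat where K: "\<forall>k\<le>h0. \<forall>u\<in>V.wt (int k). \<forall>n\<ge>int K. YM u n w = 0"
    using weight_space_truncation by blast
  have "YM u (int h - 1 - d) w \<in> {0}" if "d < - int K" "u \<in> V.wt (int h)" for d h u
    using that
  proof (induction h arbitrary: u d rule: less_induct)
    case (less h)
    show ?case
    proof (cases "h \<le> h0")
      case True
      then show ?thesis using K less.prems by auto
    next
      case False
      then have "u \<in> V.deep N0 p h" using less.prems by (intro deep) (auto simp: h0_def)
      then show ?thesis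
        unfolding V.deep_def
      proof (rule state_in_span)
        fix x assume "x \<in> {Y x (- int n - 1) b | x b k n.
          x \<in> V.wt (int k) \<and> k \<le> N0 \<and> n \<ge> p \<and> b \<in> V.wt (int h - int k - int n)}"
        then obtain y b k n where x: "x = Y y (- int n - 1) b" and y: "y \<in> V.wt (int k)" "k \<le> N0"
          and n: "n \<ge> p" and b: "b \<in> V.wt (int h - int k - int n)" by auto
        show "YM x (int h - 1 - d) w \<in> {0}"
          unfolding x
        proof (rule deep_mode_in_subspace[OF y(1) _ b])
          show "YM y j w = 0" if "j \<ge> int p" for j
            using p' y that by (auto simp: p_def)
          show "YM b (int l - 1 - d') w = 0"
            if "b \<in> V.wt (int l)" "l = h - k - n" "k + n \<le> h" "d' \<le> d + int p - int n" for l d'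
          proof -
            have "YM b (int l - 1 - d') w \<in> {0}"
              using that n less.prems(1) by (intro less.IH) (auto simp: p_def)
            then show ?thesis by simp
          qed
          show "YM u (int k' - 1 - d) w \<in> {0}" if "k' < h" "u \<in> V.wt (int k')" for u k'
            using that less.prems(1) by (intro less.IH)
        qed simp
      qed simp
    qed
  qed
  then show ?thesis by auto
qed

text \<open>Spanning sets of the weight spaces up to \<open>h1\<close> suffice: the modes of heavier
  vectors reduce to those of smaller weight.\<close>

lemma finite_dimensional_shift: "finite_dimensional scaleM (shift d w)"
proof -
  obtain p :: nat where p: "\<forall>k\<le>N0. \<forall>u\<in>V.wt (int k). \<forall>n\<ge>int p. YM u n w = 0"
    using weight_space_truncation by blast
  obtain K :: nat where K: "\<forall>d < - int K. \<forall>k. \<forall>u\<in>V.wt (int k). YM u (int k - 1 - d) w = 0"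
    using uniform_lower_bound by blast
  \<comment> \<open>For \<open>n \<ge> m\<close> the degree bound \<open>d + p - n\<close> is below
    \<open>- K\<close>, where every mode annihilates \<open>w\<close>.\<close>
  define m where "m = nat \<bar>d\<bar> + p + K + 1"
  define h1 where "h1 = m * (N0 + m)"
  have "\<forall>k. \<exists>B. finite B \<and> V.span B = V.wt (int k)"
    using V.weight_space_finite_dimensional unfolding finite_dimensional_def by blast
  then obtain B where B: "\<And>k. finite (B k)" "\<And>k. V.span (B k) = V.wt (int k)"
    by metis
  define C where "C = (\<Union>k\<le>h1. (\<lambda>b. YM b (int k - 1 - d) w) ` B k)"
  have BV: "b \<in> V.wt (int k)" if "b \<in> B k" for b k
    using V.span_base[OF that] B(2) by simp
  have "YM u (int h - 1 - d) w \<in> M.span C" if "u \<in> V.wt (int h)" for h u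
    using that
  proof (induction h arbitrary: u rule: less_induct)
    case (less h)
    show ?case
    proof (cases "h \<le> h1")
      case True
      from less.prems show ?thesis
        unfolding B(2)[symmetric]
      proof (rule state_in_span)
        fix b assume "b \<in> B h"
        then show "YM b (int h - 1 - d) w \<in> M.span C"
          unfolding C_def using True by (intro M.span_base) auto
      qed (rule M.subspace_span)
    next
      case False
      then have "u \<in> V.deep N0 m h" using less.prems by (intro deep) (auto simp: h1_def)
      then show ?thesis
        unfolding V.deep_def
      proof (rule state_in_span)
        fix x assume "x \<in> {Y x (- int n - 1) b | x b k n.
          x \<in> V.wt (int k) \<and> k \<le> N0 \<and> n \<ge> m \<and> b \<in> V.wt (int h - int k - int n)}"
        then obtain y b k n where x: "x = Y y (- int n - 1) b" and y: "y \<in> V.wt (int k)" "k \<le> N0"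
          and n: "n \<ge> m" and b: "b \<in> V.wt (int h - int k - int n)" by auto
        show "YM x (int h - 1 - d) w \<in> M.span C"
          unfolding x
        proof (rule deep_mode_in_subspace[OF y(1) _ b])
          show "YM y j w = 0" if "j \<ge> int p" for j
            using p y that by auto
          show "YM b (int l - 1 - d') w = 0"
            if "b \<in> V.wt (int l)" "l = h - k - n" "k + n \<le> h" "d' \<le> d + int p - int n" for l d'
          proof -
            have "d' < - int K" using that(4) n by (simp add: m_def)
            then show ?thesis using K that(1) by blast
          qed
          show "YM u (int k' - 1 - d) w \<in> M.span C" if "k' < h" "u \<in> V.wt (int k')" for u k'
            using that by (intro less.IH)
        qed (rule M.subspace_span)
      qed (rule M.subspace_span)
    qed
  qed
  then have "shift d w \<subseteq> M.span C"
    unfolding shift_def by (intro M.span_minimal) auto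
  moreover have C: "C \<subseteq> shift d w"
    unfolding C_def using BV by (auto intro!: in_shift)
  moreover have "M.span C \<subseteq> shift d w"
    using C subspace_shift by (rule M.span_minimal)
  moreover have "finite C"
    unfolding C_def using B(1) by auto
  ultimately show ?thesis
    unfolding finite_dimensional_def by blast
qed

end

end

section \<open>Grading an irreducible weak module by \<open>L(0)\<close>-eigenvalues\<close>

theorem corollary5p7:
  fixes scaleV :: "complex \<Rightarrow> 'v::ab_group_add \<Rightarrow> 'v"
    and Y :: "'v \<Rightarrow> int \<Rightarrow> 'v \<Rightarrow> 'v"
    and vac \<omega> :: 'v
    and scaleM :: "complex \<Rightarrow> 'm::ab_group_add \<Rightarrow> 'm"
    and YM :: "'v \<Rightarrow> int \<Rightarrow> 'm \<Rightarrow> 'm"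
  assumes "vertex_operator_algebra scaleV Y vac \<omega>"
    and "cft_type scaleV Y vac \<omega>"
    and "C2_cofinite scaleV Y"
    and "irreducible_weak_module scaleV Y vac \<omega> scaleM YM"
  shows "irreducible_ordinary_module scaleV Y vac \<omega> scaleM YM"
proof -
  interpret irreducible_weak_module scaleV Y vac \<omega> scaleM YM by fact
  interpret N: nonneg_graded_voa scaleV Y vac \<omega>
    using assms(2) by unfold_locales (simp add: cft_type_def)
  interpret nonneg_weak_module scaleV Y vac \<omega> scaleM YM
    by unfold_locales
  obtain N0 where N0: "\<And>h x. h > N0 \<Longrightarrow> x \<in> V.wt (int h) \<Longrightarrow>
    x \<in> V.span {Y c (-2) d | c d k l. c \<in> V.wt (int k) \<and> d \<in> V.wt (int l) \<and> k + l + 1 = h}"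
    using N.C2_cofinite_weights[OF assms(3)] by blast
  have deep: "x \<in> V.deep N0 m h" if "h > m * (N0 + m)" "x \<in> V.wt (int h)" for m h x
    by (rule N.weight_in_deep[OF N0 that])
  have irr: "N = {0} \<or> N = UNIV" if "submodule scaleM YM N" for N
    using irreducible that unfolding irreducible_action_def by blast
  obtain w0 :: 'm where w0: "w0 \<noteq> 0"
    using irreducible unfolding irreducible_action_def by blast
  obtain B where B: "finite B" "B \<subseteq> shift 0 w0" "M.span B = shift 0 w0"
    using finite_dimensional_shift[OF deep, of 0 w0] unfolding finite_dimensional_def by blast
  have hom: "module_hom scaleM scaleM (Lmode YM \<omega> 0)"
    unfolding Lmode_def by (rule hom_mode)
  \<comment> \<open>The degree zero span of \<open>w0\<close> is finite-dimensional, stable under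
    \<open>L(0)\<close> and contains \<open>w0\<close>.\<close>
  obtain c w where w: "w \<noteq> 0" "Lmode YM \<omega> 0 w = scaleM c w"
    using ex_eigenvector[OF M.vector_space_axioms hom subspace_shift Lzero_shift B(1) _ self_in_shift w0] B(3)
    by blast
  have "w \<in> M.span (\<Union>d. shift d w)"
    using self_in_shift by (intro M.span_base) blast
  then have all: "M.span (\<Union>d. shift d w) = UNIV"
    using irr[OF submodule_shifts[of w]] w(1) by blast
  \<comment> \<open>The grading lives on the coset of \<open>c\<close> modulo the integers, where
    \<open>d\<close> is determined by \<open>r\<close>; it is zero elsewhere.\<close>
  define W where "W r = (if \<exists>d. r = c + of_int d then shift (THE d. r = c + of_int d) w else {0})" for r
  have W: "W (c + of_int d) = shift d w" for d
    unfolding W_def by simp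
  have W0: "W r = {0}" if "\<nexists>d. r = c + of_int d" for r
    unfolding W_def using that by simp
  have eigen: "Lmode YM \<omega> 0 x = scaleM r x" if "x \<in> W r" for r x
  proof (cases "\<exists>d. r = c + of_int d")
    case True
    then show ?thesis using that W shift_eigenspace[OF w(2)] by blast
  next
    case False
    then show ?thesis using that W0[OF False] by (simp add: Lmode_def)
  qed
  have sub: "M.subspace (W r)" for r
    by (cases "\<exists>d. r = c + of_int d") (auto simp: W W0 subspace_shift)
  have "(\<Union>d. shift d w) \<subseteq> (\<Union>r. W r)" using W by blast
  then have "x \<in> M.span (\<Union>r. W r)" for x using all M.span_mono by blast
  then have direct: "is_direct_sum scaleM UNIV W"
    by (intro is_direct_sum_eigenspaces[OF M.vector_space_axioms hom sub eigen])
  have fin: "finite_dimensional scaleM (W r)" for r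
  proof (cases "\<exists>d. r = c + of_int d")
    case True
    then show ?thesis using W finite_dimensional_shift[OF deep] by auto
  next
    case False
    then show ?thesis by (auto simp: W0 finite_dimensional_def intro!: exI[of _ "{}"])
  qed
  obtain K :: nat where K: "\<forall>d < - int K. \<forall>k. \<forall>u\<in>V.wt (int k). YM u (int k - 1 - d) w = 0"
    using uniform_lower_bound[OF deep] by blast
  have shift0: "shift d w = {0}" if "d < - int K" for d
  proof -
    have "shift d w \<subseteq> {0}"
      unfolding shift_def using K that by (intro M.span_minimal) auto
    then show ?thesis using M.subspace_0[OF subspace_shift[of d w]] by blast
  qed
  have bounded: "\<exists>N::int. \<forall>n<N. W (r + of_int n) = {0}" for r
  proof (cases "\<exists>d. r = c + of_int d")
    case True
    then obtain d where d: "r = c + of_int d" by blast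
    have "W (r + of_int n) = {0}" if "n < - int K - d" for n
      using W[of "d + n"] shift0[of "d + n"] that by (simp add: d add.assoc)
    then show ?thesis by blast
  next
    case False
    have "W (r + of_int n) = {0}" for n
    proof (rule W0, rule notI)
      assume "\<exists>d. r + of_int n = c + of_int d"
      then obtain d where "r + of_int n = c + of_int d" by blast
      then have "r = c + of_int (d - n)" by (simp add: algebra_simps)
      then show False using False by blast
    qed
    then show ?thesis by blast
  qed
  show ?thesis
    using direct fin bounded eigen irreducible by unfold_locales blast+
qed

end
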